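(* Let $1\le s_1<s_2<\dots<s_k$ be fixed integers, $k\ge1$, and let $d=\gcd(s_1,\dots,s_k)$. For $n>s_k$ let $\tau(n)$ be the number of spanning trees of the circulant graph $C_{2n}(s_1,\dots,s_k,n)$. Then $$\tau(n)\sim\frac{n\,d^2}{2q}K^n\quad\text{as } n\to\infty\text{ with }\gcd(n,d)=1,$$ where $q=s_1^2+\dots+s_k^2$ and $$K=\exp\Bigl(\int_0^1\log\bigl|L^2(e^{2\pi i t})+2L(e^{2\pi i t})\bigr|\,dt\Bigr)$$ is the Mahler measure of the Laurent polynomial $L(z)(L(z)+2)$, with $L(z)=2k-\sum_{i=1}^k(z^{s_i}+z^{-s_i})$.
   Context: $C_{2n}(s_1,\dots,s_k,n)$ is the graph with vertices $0,1,\dots,2n-1$ in which each vertex $i$ is adjacent to the vertices $i\pm s_1,\dots,i\pm s_k$ and $i+n\pmod{2n}$ (a single edge joins $i$ and $i+n$, so every vertex has degree $2k+1$). The notation $f(n)\sim g(n)$ means $f(n)/g(n)\to1$. *)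

theory Defs
  imports "HOL-Analysis.Analysis" "HOL-Number_Theory.Cong"
begin

text \<open>
  A finite simple graph is given by its vertex set \<open>V\<close> and a set \<open>E\<close> of
  two-element subsets of \<open>V\<close>.
\<close>

definition graph_connected :: "'a set \<Rightarrow> 'a set set \<Rightarrow> bool" where
  "graph_connected V E \<longleftrightarrow>
     V \<noteq> {} \<and> (\<forall>u\<in>V. \<forall>v\<in>V. (u, v) \<in> {(x, y). {x, y} \<in> E}\<^sup>*)"

text \<open>A cycle is the list of its pairwise distinct vertices; the last one is joined to the first.\<close>

definition graph_cycle :: "'a set set \<Rightarrow> 'a list \<Rightarrow> bool" where
  "graph_cycle E xs \<longleftrightarrow> length xs \<ge> 3 \<and> distinct xs \<and>
     (\<forall>i<length xs. {xs ! i, xs ! (Suc i mod length xs)} \<in> E)"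

definition is_tree :: "'a set \<Rightarrow> 'a set set \<Rightarrow> bool" where
  "is_tree V E \<longleftrightarrow> graph_connected V E \<and> (\<nexists>xs. graph_cycle E xs)"

definition spanning_trees :: "'a set \<Rightarrow> 'a set set \<Rightarrow> 'a set set set" where
  "spanning_trees V E = {T. T \<subseteq> E \<and> is_tree V T}"

text \<open>
  The circulant graph on \<open>0, \<dots>, N - 1\<close> with set of jumps \<open>S\<close>: the vertex \<open>u\<close> is adjacent to
  \<open>u \<plusminus> a\<close> modulo \<open>N\<close> for each \<open>a \<in> S\<close>. The case \<open>v = u - a\<close> is written as \<open>v + a = u\<close>
  to avoid truncated subtraction. As the edges form a set, the jump \<open>a = n\<close> for \<open>N = 2 * n\<close>
  contributes the single edge joining \<open>u\<close> and \<open>u + n\<close>. There are no loops provided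
  that \<open>N\<close> divides no element of \<open>S\<close>.
\<close>

definition circulant_edges :: "nat \<Rightarrow> nat set \<Rightarrow> nat set set" where
  "circulant_edges N S = {{u, v} | u v. u \<in> {0..<N} \<and> v \<in> {0..<N} \<and>
     (\<exists>a\<in>S. [v = u + a] (mod N) \<or> [v + a = u] (mod N))}"

definition circulant_num_spanning_trees :: "nat \<Rightarrow> nat set \<Rightarrow> nat" where
  "circulant_num_spanning_trees N S = card (spanning_trees {0..<N} (circulant_edges N S))"

definition circulant_laurent :: "nat \<Rightarrow> (nat \<Rightarrow> nat) \<Rightarrow> complex \<Rightarrow> complex" where
  "circulant_laurent k s z =
     2 * of_nat k - (\<Sum>i=1..k. z powi int (s i) + z powi (- int (s i)))"

text \<open>
  The convention \<open>ln 0 = 0\<close> is immaterial when \<open>P\<close> is a nonzero Laurent polynomial, since it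
  then has only finitely many zeros on the unit circle and the singularities are integrable.
\<close>

definition mahler_measure :: "(complex \<Rightarrow> complex) \<Rightarrow> real" where
  "mahler_measure P =
     exp (integral {0..1} (\<lambda>t. ln (cmod (P (exp (2 * of_real pi * \<i> * of_real t))))))"

end

theory Submission
  imports Defs "Jordan_Normal_Form.Determinant"
    "HOL-Complex_Analysis.Cauchy_Integral_Formula"
    "HOL-Computational_Algebra.Fundamental_Theorem_Algebra"
begin

text \<open>
  The number of spanning trees is computed exactly, and only then is \<open>n\<close> sent to infinity.

  \<^emph>\<open>Exact count.\<close> By a forest version of the matrix tree theorem (\<open>det_shifted_laplacian\<close>,
  \<open>card_single_root_forests\<close>), \<open>det (x I + Laplacian)\<close> is the polynomial that counts rooted spanning
  forests by their number of roots, and its linear coefficient is the number of spanning trees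
  times the number of vertices. For a circulant graph the discrete Fourier matrix diagonalises the
  Laplacian, so this coefficient is the product of the eigenvalues other than that of the constant
  vector (\<open>circulant_num_spanning_trees_prod\<close>). For \<open>2 n\<close> vertices and the jumps
  \<open>s\<^sub>1, \<dots>, s\<^sub>k, n\<close> the eigenvalues are the values of \<open>L\<close> at the \<open>n\<close>-th roots of unity, and those
  of \<open>L + 2\<close> at the \<open>n\<close>-th roots of \<open>-1\<close>.

  On the unit circle \<open>L z\<close> is the sum of the \<open>\<bar>1 - z ^ s\<^sub>i\<bar>\<^sup>2\<close>, hence it vanishes exactly where
  \<open>z ^ d = 1\<close>, and \<open>\<bar>L z\<bar> = \<bar>z ^ d - 1\<bar>\<^sup>2 \<bar>R z\<bar>\<close> for a polynomial \<open>R\<close> without zeros on the circle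
  and with \<open>\<bar>R 1\<bar> = q / d\<^sup>2\<close>. If \<open>n\<close> is coprime to \<open>d\<close>, then raising to the power \<open>d\<close> permutes
  the \<open>n\<close>-th roots of unity, so the factors \<open>\<bar>w ^ d - 1\<bar>\<close> over all such \<open>w \<noteq> 1\<close> multiply to \<open>n\<close>.
  This is where \<open>n\<^sup>2 d\<^sup>2 / q\<close> comes from; one factor \<open>2 n\<close> is lost to the number of vertices
  (\<open>spanning_trees_exact\<close>).

  \<^emph>\<open>Asymptotics.\<close> There remain the products of \<open>\<bar>R\<bar>\<close> over the \<open>n\<close>-th roots of unity and of
  \<open>\<bar>L + 2\<bar>\<close> over the \<open>n\<close>-th roots of \<open>-1\<close>, where both functions agree in absolute value with
  polynomials that have no zero on the circle. For a linear factor \<open>z - a\<close> such a product is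
  \<open>\<bar>u ^ n - a ^ n\<bar>\<close> with \<open>\<bar>u\<bar> = 1\<close>, which is asymptotic to the \<open>n\<close>-th power of \<open>max 1 \<bar>a\<bar>\<close>, and
  this number is the Mahler measure of \<open>z - a\<close>. Hence each product is asymptotic to the \<open>n\<close>-th power
  of the Mahler measure of its polynomial, without a further constant (\<open>circle_regularI\<close>). Finally
  \<open>K\<close> is the product of these two Mahler measures, because that of \<open>z ^ d - 1\<close> is \<open>1\<close>
  (\<open>circle_mean_ln_norm_power_minus_one\<close>, \<open>log_mahler_laurent\<close>).
\<close>

section \<open>Rooted forests and the determinant of a shifted Laplacian\<close>

text \<open>
  A rooted spanning forest on \<open>{0..<N}\<close>, with edges in \<open>E\<close>, is given by its parent function; the value \<open>N\<close>
  marks a root. That no nonempty set of vertices is mapped into itself says that every vertex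
  reaches a root by passing to parents again and again. In this form the condition can be used
  without speaking of heights or iterates: one exhibits an invariant set.
\<close>

definition rooted_forests :: "nat \<Rightarrow> nat set set \<Rightarrow> (nat \<Rightarrow> nat) set" where
  "rooted_forests N E = {f \<in> {0..<N} \<rightarrow>\<^sub>E {0..N}.
     (\<forall>v<N. f v = N \<or> {v, f v} \<in> E) \<and> (\<forall>Q\<subseteq>{0..<N}. f ` Q \<subseteq> Q \<longrightarrow> Q = {})}"

text \<open>
  The shift by \<open>x\<close> keeps track of the number of roots, so that no row or column has to be deleted.
\<close>

definition shifted_laplacian :: "nat \<Rightarrow> nat set set \<Rightarrow> 'a::comm_ring_1 \<Rightarrow> 'a mat" where
  "shifted_laplacian N E x = Matrix.mat N N (\<lambda>(v, w).
     (if v = w then x + of_nat (card {u. u < N \<and> {v, u} \<in> E}) else 0) - (if {v, w} \<in> E then 1 else 0))"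

text \<open>
  Row \<open>v\<close> of \<open>x I + Laplacian\<close> is the sum of \<open>x e\<^sub>v\<close>, which makes \<open>v\<close> a root, and of
  \<open>e\<^sub>v - e\<^sub>w\<close> for the neighbours \<open>w\<close> of \<open>v\<close>, each of which makes \<open>w\<close> the parent of \<open>v\<close>. Choosing one
  summand in every row according to \<open>f\<close> gives this matrix.
\<close>

definition forest_matrix :: "nat \<Rightarrow> 'a::comm_ring_1 \<Rightarrow> (nat \<Rightarrow> nat) \<Rightarrow> 'a mat" where
  "forest_matrix N x f = Matrix.mat N N (\<lambda>(v, w).
     if f v = N then (if v = w then x else 0)
     else (if v = w then 1 else 0) - (if w = f v then 1 else 0))"

text \<open>
  Only the identity contributes to the Leibniz formula: a permutation with a nonzero term can move
  a vertex \<open>v\<close> only to \<open>f v\<close>, so the vertices that it moves form an invariant set.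
\<close>

lemma det_forest_matrix_rooted:
  assumes f: "f \<in> {0..<N} \<rightarrow> {0..N}"
    and rooted: "\<forall>Q\<subseteq>{0..<N}. f ` Q \<subseteq> Q \<longrightarrow> Q = {}"
  shows "Determinant.det (forest_matrix N x f) = x ^ card {v. v < N \<and> f v = N}"
proof -
  let ?M = "forest_matrix N x f"
  have M: "?M \<in> carrier_mat N N" by (simp add: forest_matrix_def)
  have fix_free: "f v \<noteq> v" if "v < N" for v
    using rooted[rule_format, of "{v}"] that by auto
  have zero: "signof p * (\<Prod>v = 0..<N. ?M $$ (v, p v)) = 0"
    if p: "p permutes {0..<N}" and "p \<noteq> id" for p
  proof (rule ccontr)
    assume nz: "\<not> ?thesis"
    have entry: "?M $$ (v, p v) \<noteq> 0" if "v < N" for v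
    proof
      assume "?M $$ (v, p v) = 0"
      then have "(\<Prod>v = 0..<N. ?M $$ (v, p v)) = 0"
        using that by (intro prod_zero) auto
      with nz show False by simp
    qed
    define Q where "Q = {v. p v \<noteq> v}"
    have QN: "Q \<subseteq> {0..<N}" using p by (auto simp: Q_def permutes_def)
    have "f v \<in> Q" if v: "v \<in> Q" for v
    proof -
      have vN: "v < N" using QN v by auto
      have pN: "p v < N" using permutes_in_image[OF p, of v] vN by simp
      have "p v = f v"
        using entry[OF vN] v vN pN by (auto simp: forest_matrix_def Q_def split: if_splits)
      moreover have "p (p v) \<noteq> p v"
        using permutes_inj[OF p] v by (auto simp: Q_def inj_eq)
      ultimately show ?thesis by (simp add: Q_def)
    qed
    then have "Q = {}" using rooted QN by blast
    with \<open>p \<noteq> id\<close> show False by (auto simp: Q_def)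
  qed
  have "Determinant.det ?M = (\<Sum>p\<in>{p. p permutes {0..<N}}. signof p * (\<Prod>v = 0..<N. ?M $$ (v, p v)))"
    by (rule det_def'[OF M])
  also have "\<dots> = (\<Sum>p\<in>{id}. signof p * (\<Prod>v = 0..<N. ?M $$ (v, p v)))"
    by (rule sum.mono_neutral_right) (use zero finite_permutations[of "{0..<N}"] in \<open>auto simp: permutes_id\<close>)
  also have "\<dots> = (\<Prod>v = 0..<N. if f v = N then x else 1)"
    using fix_free by (auto simp: forest_matrix_def intro!: prod.cong)
      (metis fix_free)
  also have "\<dots> = x ^ card {v. v < N \<and> f v = N}"
    by (simp add: prod.If_cases Int_def conj_commute)
  finally show ?thesis .
qed

text \<open>
  The union \<open>C\<close> of all invariant sets is also closed under taking preimages. Hence the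
  entries of its indicator vector at \<open>v\<close> and \<open>f v\<close> agree whenever \<open>v\<close> is not a root, and since
  it contains no root, this vector lies in the kernel.
\<close>

lemma det_forest_matrix_unrooted:
  fixes x :: "'a::idom"
  assumes f: "f \<in> {0..<N} \<rightarrow> {0..N}" and "Q \<subseteq> {0..<N}" "f ` Q \<subseteq> Q" "Q \<noteq> {}"
  shows "Determinant.det (forest_matrix N x f) = 0"
proof -
  let ?M = "forest_matrix N x f"
  define C where "C = \<Union>{Q. Q \<subseteq> {0..<N} \<and> f ` Q \<subseteq> Q}"
  have Cf: "f v \<in> C" if "v \<in> C" for v
    using that by (auto simp: C_def)
  have CN: "C \<subseteq> {0..<N}" by (auto simp: C_def)
  have "Q \<subseteq> C" using assms by (auto simp: C_def)
  have Cf': "v \<in> C" if "v < N" "f v \<in> C" for v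
  proof -
    have "insert v C \<subseteq> {0..<N}" "f ` insert v C \<subseteq> insert v C"
      using that CN Cf by auto
    then have "insert v C \<subseteq> C" unfolding C_def by blast
    then show ?thesis by simp
  qed
  define y where "y = Matrix.vec N (\<lambda>w. if w \<in> C then 1 else 0 :: 'a)"
  have M: "?M \<in> carrier_mat N N" by (simp add: forest_matrix_def)
  have "y \<in> carrier_vec N" by (simp add: y_def)
  moreover have "y \<noteq> 0\<^sub>v N"
  proof
    assume y0: "y = 0\<^sub>v N"
    obtain v where v: "v \<in> C" "v < N" using assms \<open>Q \<subseteq> C\<close> CN by fastforce
    then have "vec_index y v = 1" by (simp add: y_def)
    with y0 v show False by simp
  qed
  moreover have "?M *\<^sub>v y = 0\<^sub>v N"
  proof (rule eq_vecI)
    fix v assume "v < dim_vec (0\<^sub>v N :: 'a Matrix.vec)"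
    then have v: "v < N" by simp
    have NC: "N \<notin> C" using CN by auto
    have "vec_index (?M *\<^sub>v y) v = (\<Sum>w = 0..<N. ?M $$ (v, w) * (if w \<in> C then 1 else 0))"
      using v M by (auto simp: scalar_prod_def y_def intro!: sum.cong)
    also have "\<dots> = (\<Sum>w\<in>C. ?M $$ (v, w))"
      using CN by (auto simp: sum.If_cases if_distrib cong: if_cong) (simp add: Int_absorb1)
    also have "\<dots> = 0"
    proof -
      have fin: "finite C" using CN finite_subset by blast
      have *: "?M $$ (v, w) = (if f v = N then (if v = w then x else 0)
         else (if v = w then 1 else 0) - (if w = f v then 1 else 0))" if "w \<in> C" for w
        using that v CN by (auto simp: forest_matrix_def)
      have iff: "v \<in> C \<longleftrightarrow> f v \<in> C" using Cf Cf' v by blast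
      have "(\<Sum>w\<in>C. ?M $$ (v, w)) = (\<Sum>w\<in>C. if f v = N then (if v = w then x else 0)
         else (if v = w then 1 else 0) - (if w = f v then 1 else 0))"
        by (rule sum.cong[OF refl *])
      then show ?thesis
        using NC iff fin by (cases "f v = N") (auto simp: sum_subtractf)
    qed
    finally show "vec_index (?M *\<^sub>v y) v = vec_index (0\<^sub>v N) v" using v by simp
  qed (use M in auto)
  ultimately show ?thesis
    using det_0_iff_vec_prod_zero[OF M] by blast
qed

text \<open>
  The matrix tree theorem for forests: the determinant is expanded multilinearly into one summand
  for each choice of summands in the rows.
\<close>

lemma det_shifted_laplacian:
  fixes x :: "'a::idom"
  shows "Determinant.det (shifted_laplacian N E x) =
    (\<Sum>f\<in>rooted_forests N E. x ^ card {v. v < N \<and> f v = N})"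
proof -
  \<comment> \<open>The entry at \<open>w\<close> of the summand of row \<open>v\<close> that belongs to the choice \<open>c\<close>; \<open>c = N\<close> stands for a root.\<close>
  define b where "b v c w = (if c = N then (if v = w then x else 0)
     else if {v, c} \<in> E then (if v = w then 1 else 0) - (if w = c then 1 else 0) else 0)" for v c w :: nat
  let ?A = "shifted_laplacian N E x"
  have A: "?A \<in> carrier_mat N N" by (simp add: shifted_laplacian_def)
  have entry: "?A $$ (v, w) = (\<Sum>c = 0..N. b v c w)" if "v < N" "w < N" for v w
  proof -
    have "(\<Sum>c = 0..N. b v c w) = b v N w + (\<Sum>c = 0..<N. b v c w)"
      by (simp add: atLeast0AtMost lessThan_Suc_atMost[symmetric] atLeast0LessThan)
    also have "(\<Sum>c = 0..<N. b v c w) =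
        (\<Sum>c = 0..<N. (if {v, c} \<in> E then if v = w then 1 else 0 else 0) - (if c = w then if {v, w} \<in> E then 1 else 0 else 0))"
      by (rule sum.cong) (auto simp: b_def)
    also have "\<dots> = (if v = w then of_nat (card {u. u < N \<and> {v, u} \<in> E}) else 0) - (if {v, w} \<in> E then 1 else 0)"
    proof -
      have "{0..<N} \<inter> {c. {v, c} \<in> E} = {u. u < N \<and> {v, u} \<in> E}" by auto
      then show ?thesis using that
        by (simp add: sum_subtractf sum.If_cases)
    qed
    finally show ?thesis using that by (auto simp: shifted_laplacian_def b_def)
  qed
  have "Determinant.det ?A = (\<Sum>p | p permutes {0..<N}. signof p * (\<Prod>v = 0..<N. \<Sum>c = 0..N. b v c (p v)))"
    unfolding det_def'[OF A]
  proof (intro sum.cong refl arg_cong2[where f = "(*)"] prod.cong)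
    fix p v assume p: "p \<in> {p. p permutes {0..<N}}" and "v \<in> {0..<N}"
    then have "p v < N" using permutes_in_image[of p "{0..<N}" v] by simp
    then show "?A $$ (v, p v) = (\<Sum>c = 0..N. b v c (p v))" using \<open>v \<in> _\<close> by (simp add: entry)
  qed
  also have "\<dots> = (\<Sum>p | p permutes {0..<N}. \<Sum>f\<in>{0..<N} \<rightarrow>\<^sub>E {0..N}. signof p * (\<Prod>v = 0..<N. b v (f v) (p v)))"
    by (simp add: prod_sum_PiE sum_distrib_left)
  also have "\<dots> = (\<Sum>f\<in>{0..<N} \<rightarrow>\<^sub>E {0..N}. \<Sum>p | p permutes {0..<N}. signof p * (\<Prod>v = 0..<N. b v (f v) (p v)))"
    by (rule sum.swap)
  also have "\<dots> = (\<Sum>f\<in>{0..<N} \<rightarrow>\<^sub>E {0..N}. if f \<in> rooted_forests N E then x ^ card {v. v < N \<and> f v = N} else 0)"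
  proof (rule sum.cong[OF refl])
    fix f assume f: "f \<in> {0..<N} \<rightarrow>\<^sub>E {0..N}"
    then have f': "f \<in> {0..<N} \<rightarrow> {0..N}" by auto
    show "(\<Sum>p | p permutes {0..<N}. signof p * (\<Prod>v = 0..<N. b v (f v) (p v))) =
      (if f \<in> rooted_forests N E then x ^ card {v. v < N \<and> f v = N} else 0)"
    proof (cases "\<forall>v<N. f v = N \<or> {v, f v} \<in> E")
      case True
      let ?M = "forest_matrix N x f"
      have M: "?M \<in> carrier_mat N N" by (simp add: forest_matrix_def)
      have "(\<Sum>p | p permutes {0..<N}. signof p * (\<Prod>v = 0..<N. b v (f v) (p v))) = Determinant.det ?M"
        unfolding det_def'[OF M]
      proof (intro sum.cong refl arg_cong2[where f = "(*)"] prod.cong)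
        fix p v assume p: "p \<in> {p. p permutes {0..<N}}" and "v \<in> {0..<N}"
        then have "p v < N" using permutes_in_image[of p "{0..<N}" v] by simp
        then show "b v (f v) (p v) = ?M $$ (v, p v)" using \<open>v \<in> _\<close> True
          by (auto simp: b_def forest_matrix_def)
      qed
      also have "\<dots> = (if f \<in> rooted_forests N E then x ^ card {v. v < N \<and> f v = N} else 0)"
      proof (cases "\<forall>Q\<subseteq>{0..<N}. f ` Q \<subseteq> Q \<longrightarrow> Q = {}")
        case rooted: True
        then have "f \<in> rooted_forests N E" using True f by (simp add: rooted_forests_def)
        then show ?thesis using det_forest_matrix_rooted[OF f' rooted, of x] by simp
      next
        case False
        then obtain Q where "Q \<subseteq> {0..<N}" "f ` Q \<subseteq> Q" "Q \<noteq> {}" by blast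
        then have "Determinant.det ?M = 0" by (rule det_forest_matrix_unrooted[OF f'])
        moreover have "f \<notin> rooted_forests N E" using False unfolding rooted_forests_def by blast
        ultimately show ?thesis by simp
      qed
      finally show ?thesis .
    next
      case False
      then obtain v where v: "v < N" "f v \<noteq> N" "{v, f v} \<notin> E" by auto
      have "(\<Prod>v = 0..<N. b v (f v) (p v)) = 0" for p
        by (rule prod_zero) (use v in \<open>auto simp: b_def intro!: bexI[of _ v]\<close>)
      then have "(\<Sum>p | p permutes {0..<N}. signof p * (\<Prod>v = 0..<N. b v (f v) (p v))) = 0"
        by (intro sum.neutral) simp
      moreover have "f \<notin> rooted_forests N E" using False by (auto simp: rooted_forests_def)
      ultimately show ?thesis by simp
    qed
  qed
  also have "\<dots> = (\<Sum>f\<in>rooted_forests N E. x ^ card {v. v < N \<and> f v = N})"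
    by (rule sum.mono_neutral_cong_right) (auto simp: rooted_forests_def intro!: finite_PiE)
  finally show ?thesis .
qed

section \<open>Forests with one root and spanning trees\<close>

definition forest_edges :: "nat \<Rightarrow> (nat \<Rightarrow> nat) \<Rightarrow> nat set set" where
  "forest_edges N f = {{v, f v} | v. v < N \<and> f v \<noteq> N}"

definition trees_rooted_at :: "nat \<Rightarrow> nat set set \<Rightarrow> nat \<Rightarrow> (nat \<Rightarrow> nat) set" where
  "trees_rooted_at N E r = {f \<in> rooted_forests N E. {v. v < N \<and> f v = N} = {r}}"

lemma rooted_forestsD:
  assumes f: "f \<in> rooted_forests N E"
  shows "\<And>v. v < N \<Longrightarrow> f v \<noteq> N \<Longrightarrow> f v < N"
    and "\<And>v. v < N \<Longrightarrow> f v \<noteq> N \<Longrightarrow> {v, f v} \<in> E"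
    and "\<And>Q. Q \<subseteq> {0..<N} \<Longrightarrow> f ` Q \<subseteq> Q \<Longrightarrow> Q = {}"
    and "f \<in> extensional {0..<N}"
proof -
  show "f v < N" if "v < N" "f v \<noteq> N" for v
  proof -
    have "f \<in> {0..<N} \<rightarrow>\<^sub>E {0..N}" using f unfolding rooted_forests_def by blast
    from PiE_mem[OF this, of v] that show ?thesis by simp
  qed
  show "\<And>v. v < N \<Longrightarrow> f v \<noteq> N \<Longrightarrow> {v, f v} \<in> E"
    using f unfolding rooted_forests_def by blast
  show "\<And>Q. Q \<subseteq> {0..<N} \<Longrightarrow> f ` Q \<subseteq> Q \<Longrightarrow> Q = {}"
    using f unfolding rooted_forests_def by blast
  show "f \<in> extensional {0..<N}"
    using f unfolding rooted_forests_def PiE_def by blast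
qed

text \<open>
  Some vertex of a cycle is not the parent of another one, since otherwise \<open>f\<close> would permute the
  vertices of the cycle, which would be an invariant set. Both neighbours of such a vertex in the
  cycle would have to be its parent.
\<close>

lemma forest_edges_no_cycle:
  assumes f: "f \<in> rooted_forests N E"
  shows "\<not> graph_cycle (forest_edges N f) xs"
proof
  assume cyc: "graph_cycle (forest_edges N f) xs"
  define n where "n = length xs"
  have n3: "n \<ge> 3" and dist: "distinct xs"
    and edge: "\<And>i. i < n \<Longrightarrow> {xs ! i, xs ! (Suc i mod n)} \<in> forest_edges N f"
    using cyc by (auto simp: graph_cycle_def n_def)
  have xsN: "set xs \<subseteq> {0..<N}"
  proof
    fix x assume "x \<in> set xs"
    then obtain i where "i < n" "x = xs ! i" by (auto simp: in_set_conv_nth n_def)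
    with edge[of i] show "x \<in> {0..<N}"
      using rooted_forestsD(1)[OF f] by (auto simp: forest_edges_def doubleton_eq_iff)
  qed
  have "\<exists>x\<in>set xs. x \<notin> f ` set xs"
  proof (rule ccontr)
    assume "\<not> ?thesis"
    then have "set xs \<subseteq> f ` set xs" by blast
    then have "f ` set xs = set xs"
      by (metis List.finite_set card_image_le card_seteq finite_imageI)
    with rooted_forestsD(3)[OF f xsN] have "xs = []" by auto
    with n3 show False by (simp add: n_def)
  qed
  then obtain i where i: "i < n" "xs ! i \<notin> f ` set xs" by (auto simp: in_set_conv_nth n_def)
  have nbr: "y = f (xs ! i)" if "{xs ! i, y} \<in> forest_edges N f" "y \<in> set xs" for y
    using that i by (auto simp: forest_edges_def doubleton_eq_iff)
  \<comment> \<open>The index of the cyclic predecessor of \<open>xs ! i\<close>.\<close>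
  define j where "j = (if i = 0 then n - 1 else i - 1)"
  have j: "j < n" "Suc j mod n = i" using i n3 by (auto simp: j_def)
  have "xs ! j = f (xs ! i)"
    using edge[OF j(1)] j by (intro nbr nth_mem) (simp_all add: insert_commute flip: n_def)
  moreover have "xs ! (Suc i mod n) = f (xs ! i)"
    using edge[OF i(1)] n3 by (intro nbr nth_mem) (simp_all flip: n_def)
  ultimately have "j = Suc i mod n"
    using dist j n3 by (metis nth_eq_iff_index_eq n_def mod_less_divisor not_less_zero neq0_conv zero_neq_numeral order_less_le_trans zero_less_numeral)
  then show False using i n3 by (auto simp: j_def mod_Suc split: if_splits)
qed

text \<open>
  The vertices that are not connected to the root form an invariant set.
\<close>

lemma forest_edges_connected:
  assumes f: "f \<in> trees_rooted_at N E r"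
  shows "graph_connected {0..<N} (forest_edges N f)"
proof -
  have fr: "f \<in> rooted_forests N E" and root: "{v. v < N \<and> f v = N} = {r}"
    using f by (auto simp: trees_rooted_at_def)
  define R where "R = {(x, y). {x, y} \<in> forest_edges N f}"
  have "sym R" by (auto simp: R_def sym_def insert_commute)
  have "{v. v < N \<and> (v, r) \<notin> R\<^sup>*} = {}"
  proof (rule rooted_forestsD(3)[OF fr])
    show "f ` {v. v < N \<and> (v, r) \<notin> R\<^sup>*} \<subseteq> {v. v < N \<and> (v, r) \<notin> R\<^sup>*}"
    proof safe
      fix v assume v: "v < N" "(v, r) \<notin> R\<^sup>*"
      then have "v \<noteq> r" by auto
      with root v have fv: "f v \<noteq> N" by blast
      then show "f v < N" using rooted_forestsD(1)[OF fr] v by blast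
      have "(v, f v) \<in> R" using v fv by (auto simp: R_def forest_edges_def)
      then show "(f v, r) \<in> R\<^sup>* \<Longrightarrow> False" using v by (meson converse_rtrancl_into_rtrancl)
    qed
  qed auto
  then have reach: "(v, r) \<in> R\<^sup>*" if "v < N" for v using that by blast
  have "(u, v) \<in> R\<^sup>*" if "u < N" "v < N" for u v
    using reach[OF that(1)] reach[OF that(2)] \<open>sym R\<close>
    by (meson rtrancl_trans sym_rtrancl symD)
  moreover have "r < N" using root by auto
  ultimately show ?thesis by (auto simp: graph_connected_def R_def)
qed

lemma rtrancl_imp_path:
  assumes "(a, b) \<in> {(x, y). P x y}\<^sup>*"
  shows "\<exists>xs. xs \<noteq> [] \<and> distinct xs \<and> hd xs = a \<and> last xs = b \<and> successively P xs"
  using assms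
proof (induction rule: converse_rtrancl_induct)
  case base
  show ?case by (rule exI[of _ "[b]"]) auto
next
  case (step x y)
  then obtain xs where xs: "xs \<noteq> []" "distinct xs" "hd xs = y" "last xs = b" "successively P xs"
    by blast
  show ?case
  proof (cases "x \<in> set xs")
    case True
    then obtain ys zs where "xs = ys @ x # zs" by (meson split_list)
    with xs show ?thesis
      by (intro exI[of _ "x # zs"]) (auto simp: successively_append_iff)
  next
    case False
    with xs step(1) show ?thesis
      by (intro exI[of _ "x # xs"]) (auto simp: successively_Cons)
  qed
qed

text \<open>
  A simple path from \<open>a\<close> to \<open>b\<close> in \<open>T\<close> has at least three vertices, because \<open>a\<close> and \<open>b\<close> are not
  adjacent.
\<close>

lemma extra_edge_closes_cycle:
  assumes "graph_connected V T" "a \<in> V" "b \<in> V" "a \<noteq> b" "{a, b} \<notin> T"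
  shows "\<exists>xs. graph_cycle (insert {a, b} T) xs"
proof -
  have "(a, b) \<in> {(x, y). {x, y} \<in> T}\<^sup>*" using assms by (auto simp: graph_connected_def)
  from rtrancl_imp_path[OF this] obtain xs where
    xs: "xs \<noteq> []" "distinct xs" "hd xs = a" "last xs = b" "successively (\<lambda>x y. {x, y} \<in> T) xs"
    by blast
  obtain x xs' where 1: "xs = x # xs'" using xs by (cases xs) auto
  obtain y zs where 2: "xs' = y # zs" using xs 1 assms by (cases xs') auto
  have 3: "zs \<noteq> []" using xs 1 2 assms by auto
  have len: "length xs \<ge> 3" using 1 2 3 by (cases zs) auto
  have "{xs ! i, xs ! (Suc i mod length xs)} \<in> insert {a, b} T" if "i < length xs" for i
  proof (cases "Suc i = length xs")
    case True
    then have "i = length xs - 1" by simp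
    then have "xs ! i = b" "xs ! 0 = a" using xs by (simp_all add: last_conv_nth hd_conv_nth)
    then show ?thesis using True by (simp add: insert_commute)
  next
    case False
    then show ?thesis using xs that by (auto simp: successively_conv_nth)
  qed
  then show ?thesis using len xs by (auto simp: graph_cycle_def)
qed

lemma forest_edges_spanning_tree:
  assumes f: "f \<in> trees_rooted_at N E r"
  shows "forest_edges N f \<in> spanning_trees {0..<N} E"
proof -
  have fr: "f \<in> rooted_forests N E" using f by (auto simp: trees_rooted_at_def)
  then have "forest_edges N f \<subseteq> E"
    using rooted_forestsD(2)[OF fr] by (auto simp: forest_edges_def)
  then show ?thesis
    using forest_edges_no_cycle[OF fr] forest_edges_connected[OF f]
    by (auto simp: spanning_trees_def is_tree_def)
qed

text \<open>
  If \<open>f v \<noteq> g v\<close>, then \<open>g\<close> uses the edge \<open>{v, f v}\<close> in the opposite direction, so \<open>g (f v) = v\<close>.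
  Here \<open>f (f v) = v\<close> is impossible, as \<open>{v, f v}\<close> would be invariant. Thus \<open>f\<close> and \<open>g\<close> differ at \<open>f v\<close>
  as well, and the set where they differ is invariant.
\<close>

lemma forest_edges_inj: "inj_on (forest_edges N) (trees_rooted_at N E r)"
proof (rule inj_onI)
  fix f g assume f: "f \<in> trees_rooted_at N E r" and g: "g \<in> trees_rooted_at N E r"
    and eq: "forest_edges N f = forest_edges N g"
  have fr: "f \<in> rooted_forests N E" "g \<in> rooted_forests N E"
    and root: "\<And>v. v < N \<Longrightarrow> f v = N \<longleftrightarrow> v = r" "\<And>v. v < N \<Longrightarrow> g v = N \<longleftrightarrow> v = r"
    using f g by (auto simp: trees_rooted_at_def)
  have "{v. v < N \<and> f v \<noteq> g v} = {}"
  proof (rule rooted_forestsD(3)[OF fr(1)])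
    show "f ` {v. v < N \<and> f v \<noteq> g v} \<subseteq> {v. v < N \<and> f v \<noteq> g v}"
    proof safe
      fix v assume v: "v < N" "f v \<noteq> g v"
      then have fv: "f v \<noteq> N" using root by auto
      show fvN: "f v < N" using rooted_forestsD(1)[OF fr(1) v(1) fv] .
      have "{v, f v} \<in> forest_edges N g" using v fv eq by (auto simp: forest_edges_def)
      then have gfv: "g (f v) = v" using v by (auto simp: forest_edges_def doubleton_eq_iff)
      assume "f (f v) = g (f v)"
      then have "f (f v) = v" using gfv by simp
      then have "f ` {v, f v} \<subseteq> {v, f v}" by auto
      from rooted_forestsD(3)[OF fr(1) _ this] v fvN show False by auto
    qed
  qed auto
  then show "f = g"
    using rooted_forestsD(4)[OF fr(1)] rooted_forestsD(4)[OF fr(2)] by (intro extensionalityI) auto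
qed

text \<open>
  The parent of a vertex is a neighbour in \<open>T\<close> that is closer to \<open>r\<close>. These edges already connect
  all vertices, so an edge of \<open>T\<close> that was left out would close a cycle.
\<close>

lemma forest_edges_surj:
  assumes E: "\<And>e. e \<in> E \<Longrightarrow> \<exists>a b. e = {a, b} \<and> a \<noteq> b \<and> a < N \<and> b < N"
    and T: "T \<in> spanning_trees {0..<N} E" and r: "r < N"
  shows "\<exists>f\<in>trees_rooted_at N E r. forest_edges N f = T"
proof -
  have TE: "T \<subseteq> E" and conn: "graph_connected {0..<N} T" and acyc: "\<And>xs. \<not> graph_cycle T xs"
    using T by (auto simp: spanning_trees_def is_tree_def)
  define R where "R = {(x, y). {x, y} \<in> T}"
  \<comment> \<open>The distance of \<open>v\<close> from the root in \<open>T\<close>.\<close>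
  define d where "d v = (LEAST n. (v, r) \<in> R ^^ n)" for v
  have step: "\<exists>w. {v, w} \<in> T \<and> d w < d v" if "v < N" "v \<noteq> r" for v
  proof -
    have "(v, r) \<in> R\<^sup>*" using conn that r by (auto simp: graph_connected_def R_def)
    then obtain n where "(v, r) \<in> R ^^ n" by (auto simp: rtrancl_power)
    then have dv: "(v, r) \<in> R ^^ d v" unfolding d_def by (rule LeastI)
    have "d v \<noteq> 0" using dv that by (intro notI) simp
    then obtain m where m: "d v = Suc m" by (cases "d v") auto
    with dv obtain w where w: "(v, w) \<in> R" "(w, r) \<in> R ^^ m" by (metis relpow_Suc_E2)
    then have "d w \<le> m" unfolding d_def by (intro Least_le)
    with w m show ?thesis by (auto simp: R_def)
  qed
  define f where "f = (\<lambda>v\<in>{0..<N}. if v = r then N else SOME w. {v, w} \<in> T \<and> d w < d v)"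
  have f: "{v, f v} \<in> T \<and> d (f v) < d v" if "v < N" "v \<noteq> r" for v
    using someI_ex[OF step[OF that]] that by (simp add: f_def)
  have fN: "f v < N" if "v < N" "v \<noteq> r" for v
    using f[OF that] TE E[of "{v, f v}"] by (auto simp: doubleton_eq_iff)
  have fr: "f r = N" using r by (simp add: f_def)
  have "Q = {}" if Q: "Q \<subseteq> {0..<N}" "f ` Q \<subseteq> Q" for Q
  proof (rule ccontr)
    assume "Q \<noteq> {}"
    then obtain v where v: "v \<in> Q" "\<And>w. w \<in> Q \<Longrightarrow> d v \<le> d w"
      using ex_has_least_nat[of "\<lambda>v. v \<in> Q" _ d] by blast
    have "v \<noteq> r" using v(1) Q fr by force
    then have "d (f v) < d v" using f[of v] v Q by auto
    moreover have "f v \<in> Q" using v Q by auto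
    ultimately show False using v(2) by force
  qed
  moreover have "f \<in> {0..<N} \<rightarrow>\<^sub>E {0..N}"
  proof (rule PiE_I)
    fix v assume "v \<in> {0..<N}"
    then show "f v \<in> {0..N}" using fN[of v] fr by (cases "v = r") auto
  qed (simp add: f_def)
  moreover have "{v. v < N \<and> f v = N} = {r}" using fN fr r by (auto dest: less_imp_neq)
  moreover have "f v = N \<or> {v, f v} \<in> E" if "v < N" for v
    using f[OF that] TE fr by blast
  ultimately have fF: "f \<in> trees_rooted_at N E r"
    unfolding trees_rooted_at_def rooted_forests_def by blast
  have sub: "forest_edges N f \<subseteq> T"
    using f fr by (auto simp: forest_edges_def)
  have "e \<in> forest_edges N f" if e: "e \<in> T" for e
  proof (rule ccontr)
    assume ne: "e \<notin> forest_edges N f"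
    obtain a b where ab: "e = {a, b}" "a \<noteq> b" "a < N" "b < N" using E e TE by blast
    obtain xs where "graph_cycle (insert e (forest_edges N f)) xs"
      using extra_edge_closes_cycle[OF forest_edges_connected[OF fF], of a b] ab ne by auto
    then have "graph_cycle T xs" using sub e unfolding graph_cycle_def by blast
    with acyc show False by blast
  qed
  with sub fF show ?thesis by blast
qed

text \<open>
  A forest with a single root is a spanning tree with one vertex distinguished.
\<close>

lemma card_single_root_forests:
  assumes E: "\<And>e. e \<in> E \<Longrightarrow> \<exists>a b. e = {a, b} \<and> a \<noteq> b \<and> a < N \<and> b < N"
  shows "card {f \<in> rooted_forests N E. card {v. v < N \<and> f v = N} = 1} =
    N * card (spanning_trees {0..<N} E)"
proof -
  have bij: "bij_betw (forest_edges N) (trees_rooted_at N E r) (spanning_trees {0..<N} E)" if "r < N" for r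
    using forest_edges_inj[of N E r] forest_edges_spanning_tree[of _ N E r] forest_edges_surj[OF E _ that]
    unfolding bij_betw_def by blast
  have fin: "finite (rooted_forests N E)"
    by (rule finite_subset[of _ "{0..<N} \<rightarrow>\<^sub>E {0..N}"]) (auto simp: rooted_forests_def intro!: finite_PiE)
  have "{f \<in> rooted_forests N E. card {v. v < N \<and> f v = N} = 1} = (\<Union>r\<in>{0..<N}. trees_rooted_at N E r)"
    by (auto simp: trees_rooted_at_def card_1_singleton_iff)
  also have "card \<dots> = (\<Sum>r = 0..<N. card (trees_rooted_at N E r))"
    by (rule card_UN_disjoint) (auto simp: trees_rooted_at_def intro: finite_subset[OF _ fin])
  also have "\<dots> = (\<Sum>r = 0..<N. card (spanning_trees {0..<N} E))"
    by (rule sum.cong) (auto intro: bij_betw_same_card[OF bij])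
  finally show ?thesis by simp
qed

section \<open>Spanning trees of circulant graphs\<close>

lemma sum_roots_of_unity_powers:
  fixes N :: nat and z :: complex
  assumes "z ^ N = 1"
  shows "(\<Sum>j = 0..<N. z ^ j) = (if z = 1 then of_nat N else 0)"
  using assms geometric_sum[of z N] by (auto simp: atLeast0LessThan)

text \<open>
  The eigenvalue of the Laplacian for the character \<open>v \<mapsto> \<omega> ^ (j v)\<close>, where \<open>\<omega> = exp (2 \<pi> \<i> / N)\<close>.
\<close>

definition circulant_eigenvalue :: "nat \<Rightarrow> nat set \<Rightarrow> nat \<Rightarrow> complex" where
  "circulant_eigenvalue N A j = (\<Sum>a\<in>A. 1 - cis (2 * pi * real j / real N) ^ a)"

text \<open>
  The Fourier matrix \<open>F\<close> conjugates the matrix into a diagonal matrix \<open>D\<close>, and it is invertible because its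
  product with its adjoint \<open>G\<close> is \<open>N\<close> times the identity.
\<close>

lemma det_shifted_laplacian_circulant:
  assumes N: "N > 0" and A: "A \<subseteq> {0..<N}"
    and adj: "\<And>u v. u < N \<Longrightarrow> v < N \<Longrightarrow> {u, v} \<in> E \<longleftrightarrow> (\<exists>a\<in>A. (u + a) mod N = v)"
  shows "Determinant.det (shifted_laplacian N E x) = (\<Prod>j = 0..<N. x + circulant_eigenvalue N A j)"
proof -
  define w where "w j = cis (2 * pi * real j / real N)" for j :: nat
  have wN: "w j ^ N = 1" for j
  proof -
    have "real N * (2 * pi * real j / real N) = 2 * pi * real j" using N by simp
    then have "w j ^ N = cis (2 * pi * real j)" by (simp only: w_def Complex.DeMoivre)
    also have "\<dots> = 1" by (rule cis_multiple_2pi) simp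
    finally show ?thesis .
  qed
  have w_pow_mod: "w j ^ (m mod N) = w j ^ m" for j m
  proof -
    have "w j ^ m = w j ^ (m mod N + N * (m div N))" by simp
    also have "\<dots> = w j ^ (m mod N)" by (simp only: power_add power_mult wN) simp
    finally show ?thesis by simp
  qed
  have w_sym: "w j ^ v = w v ^ j" for j v
    by (simp add: w_def Complex.DeMoivre mult_ac)
  let ?L = "shifted_laplacian N E x"
  define F where "F = Matrix.mat N N (\<lambda>(v, j). w j ^ v)"
  define G where "G = Matrix.mat N N (\<lambda>(j, v). cnj (w j) ^ v)"
  define D where "D = Matrix.mat N N (\<lambda>(i, j). if i = j then x + circulant_eigenvalue N A j else 0)"
  have L: "?L \<in> carrier_mat N N" by (simp add: shifted_laplacian_def)
  have F: "F \<in> carrier_mat N N" and G: "G \<in> carrier_mat N N" and D: "D \<in> carrier_mat N N"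
    by (simp_all add: F_def G_def D_def)
  have nbrs: "bij_betw (\<lambda>a. (u + a) mod N) A {v. v < N \<and> {u, v} \<in> E}" if u: "u < N" for u
    unfolding bij_betw_def
  proof
    show "inj_on (\<lambda>a. (u + a) mod N) A"
    proof (rule inj_onI)
      fix a b assume ab: "a \<in> A" "b \<in> A" "(u + a) mod N = (u + b) mod N"
      then have "[u + a = u + b] (mod N)" by (simp add: cong_def)
      then have "[a = b] (mod N)" by (simp add: cong_add_lcancel_nat)
      moreover have "a < N" "b < N" using ab A by auto
      ultimately show "a = b" by (simp add: cong_def)
    qed
    show "(\<lambda>a. (u + a) mod N) ` A = {v. v < N \<and> {u, v} \<in> E}"
      using adj[OF u] N by auto
  qed
  have LF: "?L * F = F * D"
  proof (rule eq_matI)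
    fix u j assume "u < dim_row (F * D)" "j < dim_col (F * D)"
    then have u: "u < N" and j: "j < N" using F D by auto
    have "(?L * F) $$ (u, j) = (\<Sum>v = 0..<N. ?L $$ (u, v) * w j ^ v)"
      using u j L F by (auto simp: scalar_prod_def F_def intro!: sum.cong)
    also have "\<dots> = (\<Sum>v = 0..<N. (if v = u then (x + of_nat (card A)) * w j ^ v else 0)
        - (if {u, v} \<in> E then w j ^ v else 0))"
      using u bij_betw_same_card[OF nbrs[OF u]]
      by (intro sum.cong refl) (auto simp: shifted_laplacian_def algebra_simps)
    also have "\<dots> = (x + of_nat (card A)) * w j ^ u - (\<Sum>v\<in>{v. v < N \<and> {u, v} \<in> E}. w j ^ v)"
    proof -
      have "{0..<N} \<inter> {v. {u, v} \<in> E} = {v. v < N \<and> {u, v} \<in> E}" by auto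
      then show ?thesis using u by (simp add: sum_subtractf sum.If_cases)
    qed
    also have "(\<Sum>v\<in>{v. v < N \<and> {u, v} \<in> E}. w j ^ v) = (\<Sum>a\<in>A. w j ^ ((u + a) mod N))"
      by (rule sum.reindex_bij_betw[OF nbrs[OF u], symmetric])
    also have "\<dots> = w j ^ u * (\<Sum>a\<in>A. w j ^ a)"
      by (simp add: w_pow_mod power_add sum_distrib_left)
    also have "(x + of_nat (card A)) * w j ^ u - w j ^ u * (\<Sum>a\<in>A. w j ^ a) =
        w j ^ u * (x + circulant_eigenvalue N A j)"
      by (simp add: circulant_eigenvalue_def w_def sum_subtractf algebra_simps)
    also have "\<dots> = (F * D) $$ (u, j)"
      using u j F D by (auto simp: scalar_prod_def F_def D_def if_distrib cong: if_cong)
    finally show "(?L * F) $$ (u, j) = (F * D) $$ (u, j)" .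
  qed (use L F D in auto)
  have FG: "F * G = of_nat N \<cdot>\<^sub>m 1\<^sub>m N"
  proof (rule eq_matI)
    fix u v assume "u < dim_row (of_nat N \<cdot>\<^sub>m 1\<^sub>m N :: complex mat)" "v < dim_col (of_nat N \<cdot>\<^sub>m 1\<^sub>m N :: complex mat)"
    then have u: "u < N" and v: "v < N" by auto
    let ?z = "w u * cnj (w v)"
    have "(F * G) $$ (u, v) = (\<Sum>j = 0..<N. w j ^ u * cnj (w j) ^ v)"
      using u v F G by (auto simp: scalar_prod_def F_def G_def intro!: sum.cong)
    also have "\<dots> = (\<Sum>j = 0..<N. ?z ^ j)"
      by (simp add: power_mult_distrib w_sym flip: complex_cnj_power)
    also have "\<dots> = (if ?z = 1 then of_nat N else 0)"
      by (rule sum_roots_of_unity_powers) (simp add: power_mult_distrib wN flip: complex_cnj_power)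
    also have "?z = 1 \<longleftrightarrow> w u = w v"
    proof -
      have "w v * cnj (w v) = 1" by (simp add: w_def cis_cnj cis_mult)
      then show ?thesis by (metis mult.commute mult.left_commute mult.right_neutral)
    qed
    also have "w u = w v \<longleftrightarrow> u = v"
    proof -
      have "inj_on w {..<N}" using Complex.bij_betw_roots_unity[OF N] unfolding w_def bij_betw_def by blast
      then show ?thesis using u v by (auto simp: inj_on_def)
    qed
    finally show "(F * G) $$ (u, v) = (of_nat N \<cdot>\<^sub>m 1\<^sub>m N) $$ (u, v)" using u v by simp
  qed (use F G in auto)
  have "Determinant.det F * Determinant.det G = of_nat N ^ N"
    using det_mult[OF F G] by (simp add: FG)
  then have F0: "Determinant.det F \<noteq> 0" using N by auto
  have "Determinant.det ?L * Determinant.det F = Determinant.det (F * D)"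
    using det_mult[OF L F] LF by simp
  also have "\<dots> = Determinant.det F * Determinant.det D" by (rule det_mult[OF F D])
  finally have "Determinant.det ?L * Determinant.det F = Determinant.det F * Determinant.det D" .
  then have "Determinant.det ?L = Determinant.det D" using F0 by simp
  also have "\<dots> = prod_list (diag_mat D)"
    by (rule det_upper_triangular[OF _ D]) (auto simp: D_def upper_triangular_def)
  also have "\<dots> = (\<Prod>j = 0..<N. x + circulant_eigenvalue N A j)"
    by (simp add: diag_mat_def D_def prod.list_conv_set_nth)
  finally show ?thesis .
qed

text \<open>
  The forest polynomial is divisible by \<open>x\<close>, since every forest has a root, and so is the product
  of the \<open>x + \<lambda>\<^sub>j\<close>, since \<open>\<lambda>\<^sub>0 = 0\<close>. After division by \<open>x\<close> the limit \<open>x \<rightarrow> 0\<close> isolates the forests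
  with one root.
\<close>

theorem circulant_spanning_trees:
  assumes N: "N > 0" and A: "A \<subseteq> {1..<N}"
    and E: "\<And>e. e \<in> E \<Longrightarrow> \<exists>a b. e = {a, b} \<and> a \<noteq> b \<and> a < N \<and> b < N"
    and adj: "\<And>u v. u < N \<Longrightarrow> v < N \<Longrightarrow> {u, v} \<in> E \<longleftrightarrow> (\<exists>a\<in>A. (u + a) mod N = v)"
  shows "of_nat (N * card (spanning_trees {0..<N} E)) = (\<Prod>j = 1..<N. circulant_eigenvalue N A j)"
proof -
  define r where "r f = card {v. v < N \<and> f v = N}" for f :: "nat \<Rightarrow> nat"
  let ?F = "rooted_forests N E"
  have fin: "finite ?F"
    by (rule finite_subset[of _ "{0..<N} \<rightarrow>\<^sub>E {0..N}"]) (auto simp: rooted_forests_def intro!: finite_PiE)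
  have r_pos: "r f \<ge> 1" if f: "f \<in> ?F" for f
  proof (rule ccontr)
    assume "\<not> r f \<ge> 1"
    then have "r f = 0" by linarith
    then have "card {v. v < N \<and> f v = N} = 0" by (simp only: r_def)
    then have "{v. v < N \<and> f v = N} = {}" by (subst (asm) card_0_eq) auto
    then have "f ` {0..<N} \<subseteq> {0..<N}" using rooted_forestsD(1)[OF f] by auto
    with rooted_forestsD(3)[OF f, of "{0..<N}"] N show False by auto
  qed
  have ev0: "circulant_eigenvalue N A 0 = 0" by (simp add: circulant_eigenvalue_def)
  have split: "{0..<N} = insert 0 {1..<N}" using N by auto
  have eq: "(\<Sum>f\<in>?F. x ^ (r f - 1)) = (\<Prod>j = 1..<N. x + circulant_eigenvalue N A j)" if "x \<noteq> 0" for x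
  proof -
    have "x * (\<Sum>f\<in>?F. x ^ (r f - 1)) = (\<Sum>f\<in>?F. x ^ r f)"
      unfolding sum_distrib_left
    proof (rule sum.cong[OF refl])
      fix f assume "f \<in> ?F"
      then have "r f = Suc (r f - 1)" using r_pos by fastforce
      then show "x * x ^ (r f - 1) = x ^ r f" by (metis power_Suc)
    qed
    also have "\<dots> = (\<Prod>j = 0..<N. x + circulant_eigenvalue N A j)"
      unfolding r_def det_shifted_laplacian[symmetric]
      by (rule det_shifted_laplacian_circulant) (use assms in auto)
    also have "\<dots> = x * (\<Prod>j = 1..<N. x + circulant_eigenvalue N A j)"
      unfolding split by (simp add: ev0)
    finally show ?thesis using that by simp
  qed
  have "((\<lambda>x. \<Prod>j = 1..<N. x + circulant_eigenvalue N A j) \<longlongrightarrow> (\<Prod>j = 1..<N. 0 + circulant_eigenvalue N A j)) (at 0)"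
    by (intro tendsto_intros)
  moreover have "((\<lambda>x. \<Prod>j = 1..<N. x + circulant_eigenvalue N A j) \<longlongrightarrow> (\<Sum>f\<in>?F. 0 ^ (r f - 1))) (at 0)"
  proof (rule Lim_transform_eventually)
    show "((\<lambda>x::complex. \<Sum>f\<in>?F. x ^ (r f - 1)) \<longlongrightarrow> (\<Sum>f\<in>?F. 0 ^ (r f - 1))) (at 0)"
      by (intro tendsto_intros)
    show "\<forall>\<^sub>F x in at 0. (\<Sum>f\<in>?F. x ^ (r f - 1)) = (\<Prod>j = 1..<N. x + circulant_eigenvalue N A j)"
      using eq by (auto simp: eventually_at intro!: exI[of _ 1])
  qed
  ultimately have "(\<Prod>j = 1..<N. circulant_eigenvalue N A j) = (\<Sum>f\<in>?F. 0 ^ (r f - 1))"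
    using tendsto_unique[of "at (0::complex)"] by fastforce
  also have "\<dots> = (\<Sum>f\<in>?F. if r f = 1 then 1 else 0)"
    by (rule sum.cong) (use r_pos in \<open>auto simp: power_0_left dest: le_antisym\<close>)
  also have "\<dots> = of_nat (card {f\<in>?F. r f = 1})"
    using fin by (simp add: sum.If_cases Int_def)
  also have "card {f\<in>?F. r f = 1} = N * card (spanning_trees {0..<N} E)"
    unfolding r_def by (rule card_single_root_forests[OF E])
  finally show ?thesis by simp
qed

text \<open>
  Replacing the jump \<open>-a\<close> by \<open>N - a\<close> expresses adjacency by a single set of residues.
\<close>

lemma circulant_edges_iff:
  assumes S: "S \<subseteq> {1..<N}" and u: "u < N" and v: "v < N"
  shows "{u, v} \<in> circulant_edges N S \<longleftrightarrow> (\<exists>a\<in>S \<union> (\<lambda>a. N - a) ` S. (u + a) mod N = v)"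
proof -
  let ?C = "\<lambda>u v. \<exists>a\<in>S. [v = u + a] (mod N) \<or> [v + a = u] (mod N)"
  have "?C u v \<longleftrightarrow> ?C v u" by (metis cong_sym)
  then have "{u, v} \<in> circulant_edges N S \<longleftrightarrow> ?C u v"
    using u v by (auto simp: circulant_edges_def doubleton_eq_iff)
  moreover have "[v = u + a] (mod N) \<longleftrightarrow> (u + a) mod N = v" for a
    using v by (auto simp: cong_def)
  moreover have "[v + a = u] (mod N) \<longleftrightarrow> (u + (N - a)) mod N = v" if "a \<in> S" for a
  proof -
    have aN: "a < N" using that S by auto
    have "[v + a = u] (mod N) \<longleftrightarrow> [v + a + (N - a) = u + (N - a)] (mod N)"
      by (simp only: cong_add_rcancel_nat)
    also have "v + a + (N - a) = v + N" using aN by simp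
    also have "[v + N = u + (N - a)] (mod N) \<longleftrightarrow> (u + (N - a)) mod N = v"
      using v by (auto simp: cong_def)
    finally show ?thesis .
  qed
  ultimately show ?thesis by (simp add: bex_Un) blast
qed

theorem circulant_num_spanning_trees_prod:
  assumes N: "N > 0" and S: "S \<subseteq> {1..<N}"
  shows "of_nat (N * circulant_num_spanning_trees N S) =
    (\<Prod>j = 1..<N. circulant_eigenvalue N (S \<union> (\<lambda>a. N - a) ` S) j)"
  unfolding circulant_num_spanning_trees_def
proof (rule circulant_spanning_trees[OF N])
  let ?A = "S \<union> (\<lambda>a. N - a) ` S"
  show A: "?A \<subseteq> {1..<N}" using S by fastforce
  show "{u, v} \<in> circulant_edges N S \<longleftrightarrow> (\<exists>a\<in>?A. (u + a) mod N = v)" if "u < N" "v < N" for u v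
    by (rule circulant_edges_iff[OF S that])
  fix e assume e: "e \<in> circulant_edges N S"
  then obtain u v where uv: "e = {u, v}" "u < N" "v < N" by (auto simp: circulant_edges_def)
  then obtain a where a: "a \<in> ?A" "(u + a) mod N = v"
    using e circulant_edges_iff[OF S uv(2,3)] by blast
  have "0 < a" "a < N" using A a(1) by force+
  then have "u \<noteq> v" using a(2) uv(2) by (cases "u + a < N") (auto simp: le_mod_geq)
  with uv show "\<exists>a b. e = {a, b} \<and> a \<noteq> b \<and> a < N \<and> b < N" by blast
qed

section \<open>Products over roots of unity\<close>

lemma roots_of_unity_factorization:
  assumes n: "n > 0"
  shows "(\<Prod>w | w ^ n = 1. [:-w, 1:]) = (monom 1 n - 1 :: complex poly)"
proof (rule poly_eqI_degree_lead_coeff)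
  let ?U = "{w::complex. w ^ n = 1}"
  have fin: "finite ?U" and card: "card ?U = n" using n by (auto simp: finite_roots_unity card_roots_unity_eq)
  have deg: "degree (\<Prod>w\<in>?U. [:-w, 1:]) = n" by (simp add: degree_prod_sum_eq card)
  moreover have "lead_coeff (\<Prod>w\<in>?U. [:-w, 1:]) = 1" by (simp add: lead_coeff_prod)
  ultimately show "coeff (\<Prod>w\<in>?U. [:-w, 1:]) n = coeff (monom 1 n - 1) n" using n by simp
  show "degree (\<Prod>w\<in>?U. [:-w, 1:]) \<le> n" using deg by simp
  show "degree (monom 1 n - 1 :: complex poly) \<le> n"
    by (rule degree_diff_le) (auto simp: degree_monom_le)
  show "card ?U \<ge> n" using card by simp
  show "poly (\<Prod>w\<in>?U. [:-w, 1:]) z = poly (monom 1 n - 1) z" if "z \<in> ?U" for z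
    using that fin by (auto simp: poly_prod poly_monom prod_zero_iff)
qed

lemma prod_roots_of_unity_reindex:
  assumes "n > 0"
  shows "(\<Prod>j<n. g (cis (2 * pi * real j / real n))) = (\<Prod>w | w ^ n = 1. g w)"
  using prod.reindex_bij_betw[OF Complex.bij_betw_roots_unity[OF assms]] .

text \<open>
  This is the factorisation of \<open>X ^ n - 1\<close> at \<open>X = a / u\<close>, made homogeneous.
\<close>

lemma prod_norm_rotated_roots:
  assumes n: "n > 0" and u: "cmod u = 1"
  shows "(\<Prod>j<n. cmod (u * cis (2 * pi * real j / real n) - a)) = cmod (u ^ n - a ^ n)"
proof -
  have u0: "u \<noteq> 0" using u by auto
  have "(\<Prod>j<n. cmod (u * cis (2 * pi * real j / real n) - a)) = (\<Prod>w | w ^ n = 1. cmod (u * w - a))"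
    by (rule prod_roots_of_unity_reindex[OF n])
  also have "\<dots> = (\<Prod>w | w ^ n = 1. cmod (a / u - w))"
  proof (rule prod.cong[OF refl])
    fix w :: complex
    have "cmod (u * w - a) = cmod (u * (a / u - w))"
      using u0 by (subst norm_minus_commute) (simp add: right_diff_distrib)
    then show "cmod (u * w - a) = cmod (a / u - w)" by (simp add: norm_mult u)
  qed
  also have "\<dots> = cmod (poly (\<Prod>w | w ^ n = 1. [:-w, 1:]) (a / u))"
    by (simp add: poly_prod prod_norm)
  also have "\<dots> = cmod ((a / u) ^ n - 1)"
    by (simp add: roots_of_unity_factorization[OF n] poly_monom)
  also have "\<dots> = cmod (u ^ n * ((a / u) ^ n - 1))" by (simp add: norm_mult norm_power u)
  also have "u ^ n * ((a / u) ^ n - 1) = a ^ n - u ^ n" using u0 by (simp add: field_simps power_divide)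
  finally show ?thesis by (simp add: norm_minus_commute)
qed

text \<open>
  The inverse map raises to a power \<open>x\<close> with \<open>d x \<equiv> 1\<close> modulo \<open>n\<close>.
\<close>

lemma bij_betw_power_roots_of_unity:
  assumes n: "n > 0" and "coprime n d"
  shows "bij_betw (\<lambda>w::complex. w ^ d) {w. w ^ n = 1} {w. w ^ n = 1}"
proof -
  let ?U = "{w::complex. w ^ n = 1}"
  have fin: "finite ?U" using n by (simp add: finite_roots_unity)
  obtain x where x: "[d * x = 1] (mod n)"
    using cong_solve_coprime_nat[of d n] assms by (auto simp: coprime_commute)
  have "inj_on (\<lambda>w::complex. w ^ d) ?U"
  proof (rule inj_on_inverseI)
    fix w assume w: "w \<in> ?U"
    have mod: "w ^ m = w ^ (m mod n)" for m
    proof -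
      have "w ^ m = w ^ (m mod n + n * (m div n))" by simp
      also have "\<dots> = w ^ (m mod n)" using w by (simp only: power_add power_mult) simp
      finally show ?thesis .
    qed
    have "(w ^ d) ^ x = w ^ (d * x)" by (simp add: power_mult)
    also have "\<dots> = w ^ 1" using mod[of "d * x"] mod[of 1] x by (simp add: cong_def)
    finally show "(w ^ d) ^ x = w" by simp
  qed
  moreover have "(\<lambda>w. w ^ d) ` ?U \<subseteq> ?U"
    by auto (metis mult.commute power_mult power_one)
  ultimately show ?thesis using fin
    by (simp add: bij_betw_def endo_inj_surj)
qed

text \<open>
  Both sides are the value at \<open>1\<close> of \<open>(X ^ n - 1) / (X - 1) = 1 + X + \<dots> + X ^ (n - 1)\<close>.
\<close>

lemma prod_one_minus_roots_of_unity:
  assumes n: "n > 0"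
  shows "(\<Prod>w\<in>{w::complex. w ^ n = 1} - {1}. 1 - w) = of_nat n"
proof -
  let ?U = "{w::complex. w ^ n = 1}"
  have fin: "finite ?U" using n by (simp add: finite_roots_unity)
  have "[:-1, 1:] * (\<Prod>w\<in>?U - {1}. [:-w, 1:]) = (\<Prod>w\<in>?U. [:-w, 1:])"
    using fin by (subst prod.remove[of ?U 1]) auto
  also have "\<dots> = [:-1, 1:] * (\<Sum>i<n. monom 1 i)"
  proof (rule poly_ext)
    fix x :: complex
    show "poly (\<Prod>w\<in>?U. [:-w, 1:]) x = poly ([:-1, 1:] * (\<Sum>i<n. monom 1 i)) x"
      unfolding roots_of_unity_factorization[OF n]
      by (simp add: poly_monom poly_sum power_diff_1_eq algebra_simps)
  qed
  finally have "(\<Prod>w\<in>?U - {1}. [:-w, 1:]) = (\<Sum>i<n. monom 1 i)" by (simp del: mult_pCons_left)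
  then have "poly (\<Prod>w\<in>?U - {1}. [:-w, 1:]) 1 = poly (\<Sum>i<n. monom 1 i) 1" by simp
  then show ?thesis by (simp add: poly_prod poly_sum poly_monom)
qed

lemma prod_one_minus_coprime_powers:
  assumes n: "n > 0" and cop: "coprime n d"
  shows "(\<Prod>w\<in>{w::complex. w ^ n = 1} - {1}. 1 - w ^ d) = of_nat n"
proof -
  let ?U = "{w::complex. w ^ n = 1}"
  have "bij_betw (\<lambda>w::complex. w ^ d) (?U - {1}) (?U - {1 ^ d})"
    by (rule bij_betw_DiffI[OF bij_betw_power_roots_of_unity[OF n cop]]) auto
  from prod.reindex_bij_betw[OF this, of "\<lambda>w. 1 - w"] show ?thesis
    using prod_one_minus_roots_of_unity[OF n] by simp
qed

section \<open>Logarithmic means over the unit circle\<close>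

lemma circle_mean_value:
  assumes "f holomorphic_on cball 0 1"
  shows "((\<lambda>t. f (cis (2 * pi * t))) has_integral f 0) {0..1}"
proof -
  have "((\<lambda>u. f u / (u - 0)) has_contour_integral (2 * of_real pi * \<i> * f 0)) (circlepath 0 1)"
    by (rule Cauchy_integral_circlepath_simple[OF assms]) simp
  then have "((\<lambda>t. f (circlepath 0 1 t) / circlepath 0 1 t * vector_derivative (circlepath 0 1) (at t))
      has_integral 2 * of_real pi * \<i> * f 0) {0..1}"
    by (simp add: has_contour_integral)
  then have "((\<lambda>t. 1 / (2 * of_real pi * \<i>) * (f (circlepath 0 1 t) / circlepath 0 1 t * vector_derivative (circlepath 0 1) (at t)))
      has_integral 1 / (2 * of_real pi * \<i>) * (2 * of_real pi * \<i> * f 0)) {0..1}"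
    by (rule has_integral_mult_right)
  moreover have "1 / (2 * of_real pi * \<i>) * (f (circlepath 0 1 t) / circlepath 0 1 t * vector_derivative (circlepath 0 1) (at t))
      = f (cis (2 * pi * t))" for t
  proof -
    have "circlepath 0 1 t = cis (2 * pi * t)"
      by (simp add: circlepath cis_conv_exp mult_ac)
    moreover have "vector_derivative (circlepath 0 1) (at t) = 2 * of_real pi * \<i> * cis (2 * pi * t)"
      by (simp add: vector_derivative_circlepath cis_conv_exp mult_ac)
    ultimately show ?thesis by simp
  qed
  ultimately show ?thesis by simp
qed

text \<open>
  The values of \<open>1 - h\<close> have positive real part, so \<open>ln \<bar>1 - h\<bar>\<close> is the real part of a holomorphic
  function, to which the mean value property applies.
\<close>

lemma circle_mean_ln_norm_one_minus:
  assumes h: "h holomorphic_on cball 0 1" and less: "\<And>z. norm z \<le> 1 \<Longrightarrow> norm (h z) < 1"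
  shows "((\<lambda>t. ln (cmod (1 - h (cis (2 * pi * t))))) has_integral ln (cmod (1 - h 0))) {0..1}"
proof -
  have Re_pos: "Re (1 - h z) > 0" if "norm z \<le> 1" for z
    using less[OF that] complex_Re_le_cmod[of "h z"] by simp
  then have off: "1 - h z \<notin> \<real>\<^sub>\<le>\<^sub>0" if "norm z \<le> 1" for z
    using that complex_nonpos_Reals_iff by (force simp: not_le)
  have nz: "1 - h z \<noteq> 0" if "norm z \<le> 1" for z using off[OF that] by auto
  have "(\<lambda>z. Ln (1 - h z)) holomorphic_on cball 0 1"
    using off by (intro holomorphic_intros h) auto
  from has_integral_linear[OF circle_mean_value[OF this] bounded_linear_Re]
  show ?thesis using nz by (simp add: o_def Re_Ln)
qed

lemma circle_mean_ln_norm_outside: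
  assumes a: "cmod a > 1"
  shows "((\<lambda>t. ln (cmod (cis (2 * pi * t) - a))) has_integral ln (cmod a)) {0..1}"
proof -
  have "((\<lambda>t. ln (cmod (1 - cis (2 * pi * t) / a))) has_integral ln (cmod (1 - 0 / a))) {0..1}"
    by (rule circle_mean_ln_norm_one_minus) (use a in \<open>auto intro!: holomorphic_intros simp: norm_divide divide_simps\<close>)
  then have "((\<lambda>t. ln (cmod a) + ln (cmod (1 - cis (2 * pi * t) / a))) has_integral ln (cmod a)) {0..1}"
    using has_integral_add[OF has_integral_const_real[of "ln (cmod a)" 0 1]] by fastforce
  moreover have "ln (cmod a) + ln (cmod (1 - cis (2 * pi * t) / a)) = ln (cmod (cis (2 * pi * t) - a))" for t
  proof -
    have "cmod (cis (2 * pi * t) - a) = cmod (a * (1 - cis (2 * pi * t) / a))"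
      using a by (subst norm_minus_commute) (auto simp: right_diff_distrib)
    moreover have "1 - cis (2 * pi * t) / a \<noteq> 0" using a by (auto simp: field_simps)
    ultimately show ?thesis using a by (auto simp: norm_mult ln_mult)
  qed
  ultimately show ?thesis by simp
qed

text \<open>
  On the circle \<open>\<bar>z - a\<bar> = \<bar>1 - cnj a * z\<bar>\<close>, and the right-hand side comes from a function that is
  \<open>1\<close> at the centre and has no zero in the closed disc.
\<close>

lemma circle_mean_ln_norm_inside:
  assumes a: "cmod a < 1"
  shows "((\<lambda>t. ln (cmod (cis (2 * pi * t) - a))) has_integral 0) {0..1}"
proof -
  have "((\<lambda>t. ln (cmod (1 - cnj a * cis (2 * pi * t)))) has_integral ln (cmod (1 - cnj a * 0))) {0..1}"
  proof (rule circle_mean_ln_norm_one_minus)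
    fix z :: complex assume "cmod z \<le> 1"
    then have "cmod a * cmod z \<le> cmod a * 1" by (intro mult_left_mono) auto
    with a show "cmod (cnj a * z) < 1" by (simp add: norm_mult)
  qed (intro holomorphic_intros)
  moreover have "cmod (1 - cnj a * cis (2 * pi * t)) = cmod (cis (2 * pi * t) - a)" for t
  proof -
    have "cmod (cis (2 * pi * t) - a) = cmod (cnj (cis (2 * pi * t)) - cnj a)"
      by (metis complex_cnj_diff complex_mod_cnj)
    also have "\<dots> = cmod (cis (2 * pi * t) * (cnj (cis (2 * pi * t)) - cnj a))"
      by (simp add: norm_mult)
    also have "cis (2 * pi * t) * (cnj (cis (2 * pi * t)) - cnj a) = 1 - cnj a * cis (2 * pi * t)"
      by (simp add: algebra_simps cis_cnj cis_mult)
    finally show ?thesis ..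
  qed
  ultimately show ?thesis by simp
qed

text \<open>
  The square of the ratio is \<open>1 - 2 (1 + Re z) r / (1 + r)\<^sup>2\<close>, and \<open>r / (1 + r)\<^sup>2\<close> increases on
  \<open>[0, 1]\<close>. The modulus \<open>\<bar>1 - r z\<bar>\<close> itself is not monotone in \<open>r\<close>; dividing it by \<open>1 + r\<close> makes
  monotone convergence available.
\<close>

lemma norm_one_minus_ratio_antimono:
  fixes z :: complex
  assumes z: "cmod z = 1" and r: "0 \<le> r" "r \<le> s" "s \<le> 1"
  shows "cmod (1 - of_real s * z) / (1 + s) \<le> cmod (1 - of_real r * z) / (1 + r)"
proof -
  define c where "c = Re z"
  have c: "c \<ge> -1" using abs_Re_le_cmod[of z] z by (simp add: c_def)
  have Im: "(Im z)\<^sup>2 = 1 - c\<^sup>2" using cmod_power2[of z] z by (simp add: c_def)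
  have sq: "(cmod (1 - of_real x * z))\<^sup>2 = (1 + x)\<^sup>2 - 2 * x * (1 + c)" for x
    unfolding cmod_power2 using Im by (simp add: c_def power2_eq_square algebra_simps)
      (metis (no_types, lifting) Im c_def distrib_left mult.left_commute mult.right_neutral power2_eq_square add_diff_cancel_left' diff_add_cancel)
  have "(cmod (1 - of_real s * z) / (1 + s))\<^sup>2 \<le> (cmod (1 - of_real r * z) / (1 + r))\<^sup>2"
  proof -
    have "0 \<le> (s - r) * (1 - r * s)" using r mult_mono[of r 1 s 1] by (intro mult_nonneg_nonneg) auto
    then have "r * (1 + s)\<^sup>2 \<le> s * (1 + r)\<^sup>2" by (simp add: power2_eq_square algebra_simps)
    then have "r / (1 + r)\<^sup>2 \<le> s / (1 + s)\<^sup>2" using r by (simp add: divide_simps) 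
    then have "r / (1 + r)\<^sup>2 * (2 * (1 + c)) \<le> s / (1 + s)\<^sup>2 * (2 * (1 + c))"
      using c by (intro mult_right_mono) auto
    moreover have "(cmod (1 - of_real x * z) / (1 + x))\<^sup>2 = 1 - x / (1 + x)\<^sup>2 * (2 * (1 + c))" if "0 \<le> x" for x
      using that unfolding power_divide sq by (simp add: diff_divide_distrib)
    ultimately show ?thesis using r by simp
  qed
  then show ?thesis by (rule power2_le_imp_le) (use r in simp)
qed

lemma finite_times_of_roots_of_unity:
  assumes "d > 0"
  shows "finite {t \<in> {0..1}. cis (2 * pi * t) ^ d = 1}"
proof (rule finite_subset)
  show "{t \<in> {0..1}. cis (2 * pi * t) ^ d = 1} \<subseteq> (\<lambda>m. real_of_int m / real d) ` {0..int d}"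
  proof safe
    fix t :: real assume t: "t \<in> {0..1}" "cis (2 * pi * t) ^ d = 1"
    then have "cos (real d * (2 * pi * t)) = 1" by (simp add: Complex.DeMoivre complex_eq_iff)
    then obtain m :: int where "real d * (2 * pi * t) = of_int m * 2 * pi"
      using cos_one_2pi_int by blast
    then have m: "real d * t = of_int m" by simp
    have "0 \<le> real d * t" "real d * t \<le> real d * 1" using t by (auto intro!: mult_left_mono mult_nonneg_nonneg simp del: mult_1_right)
    with m have "m \<in> {0..int d}" by auto
    moreover have "t = of_int m / real d" using m assms by (simp add: field_simps)
    ultimately show "t \<in> (\<lambda>m. real_of_int m / real d) ` {0..int d}" by blast
  qed
qed auto

text \<open>
  For \<open>r < 1\<close> the mean of \<open>ln \<bar>1 - r z ^ d\<bar>\<close> is \<open>0\<close> by the mean value property. As \<open>r\<close> tends to \<open>1\<close>,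
  the functions \<open>ln (\<bar>1 - r z ^ d\<bar> / (1 + r))\<close> decrease to their limit outside the finitely many
  singularities, while their means \<open>- ln (1 + r)\<close> stay bounded; monotone convergence gives both the
  integrability of the limit and its mean.
\<close>

lemma circle_mean_ln_norm_power_minus_one:
  assumes d: "d > 0"
  shows "((\<lambda>t. ln (cmod (cis (2 * pi * t) ^ d - 1))) has_integral 0) {0..1}"
proof -
  \<comment> \<open>Any sequence in \<open>[0, 1)\<close> that increases to \<open>1\<close> would do.\<close>
  define r where "r k = 1 - 1 / real (k + 2)" for k :: nat
  define Z where "Z = {t \<in> {0..1::real}. cis (2 * pi * t) ^ d = 1}"
  have Z: "finite Z" unfolding Z_def by (rule finite_times_of_roots_of_unity[OF d])
  have r: "0 \<le> r k" "r k < 1" "r k \<le> r (Suc k)" for k by (auto simp: r_def field_simps)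
  have r_lim: "r \<longlonglongrightarrow> 1" unfolding r_def by real_asymp
  \<comment> \<open>The value \<open>0\<close> on \<open>Z\<close> makes the pointwise convergence hold on the whole interval.\<close>
  define F where "F k t = (if t \<in> Z then 0 else ln (cmod (1 - of_real (r k) * cis (2 * pi * t) ^ d) / (1 + r k)))" for k t
  define G where "G t = (if t \<in> Z then 0 else ln (cmod (1 - cis (2 * pi * t) ^ d) / 2))" for t
  have pos: "cmod (1 - of_real (r k) * cis (2 * pi * t) ^ d) > 0" for k t
  proof -
    have "cmod (of_real (r k) * cis (2 * pi * t) ^ d) < 1" using r[of k] by (simp add: norm_mult norm_power)
    then show ?thesis by auto
  qed
  have F_int: "(F k has_integral - ln (1 + r k)) {0..1}" for k
  proof -
    have "((\<lambda>t. ln (cmod (1 - of_real (r k) * cis (2 * pi * t) ^ d))) has_integral ln (cmod (1 - of_real (r k) * 0 ^ d))) {0..1}"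
    proof (rule circle_mean_ln_norm_one_minus)
      fix z :: complex assume "cmod z \<le> 1"
      then have "cmod z ^ d \<le> 1" by (simp add: power_le_one)
      then have "r k * cmod z ^ d \<le> r k * 1" using r[of k] by (intro mult_left_mono) auto
      then show "cmod (of_real (r k) * z ^ d) < 1" using r[of k] by (simp add: norm_mult norm_power)
    qed (intro holomorphic_intros)
    from has_integral_diff[OF this has_integral_const_real[of "ln (1 + r k)" 0 1]]
    have int: "((\<lambda>t. ln (cmod (1 - of_real (r k) * cis (2 * pi * t) ^ d)) - ln (1 + r k)) has_integral - ln (1 + r k)) {0..1}"
      using d by (simp add: zero_power)
    have "1 + r k > 0" using r(1)[of k] by linarith
    then show ?thesis
      by (intro has_integral_spike_finite[OF Z _ int]) (use pos in \<open>auto simp: F_def ln_div\<close>)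
  qed
  have mono: "F (Suc k) t \<le> F k t" for k t
  proof (cases "t \<in> Z")
    case False
    have "cmod (1 - of_real (r (Suc k)) * cis (2 * pi * t) ^ d) / (1 + r (Suc k))
        \<le> cmod (1 - of_real (r k) * cis (2 * pi * t) ^ d) / (1 + r k)"
      by (rule norm_one_minus_ratio_antimono) (use r[of k] r[of "Suc k"] in \<open>auto simp: norm_power\<close>)
    moreover have "0 < cmod (1 - of_real (r (Suc k)) * cis (2 * pi * t) ^ d) / (1 + r (Suc k))"
      using pos r[of "Suc k"] by (intro divide_pos_pos) auto
    ultimately show ?thesis using False by (simp add: F_def)
  qed (simp add: F_def)
  have lim: "(\<lambda>k. F k t) \<longlonglongrightarrow> G t" if t: "t \<in> {0..1}" for t
  proof (cases "t \<in> Z")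
    case False
    then have "cmod (1 - cis (2 * pi * t) ^ d) \<noteq> 0" using t by (auto simp: Z_def)
    then have "(\<lambda>k. ln (cmod (1 - of_real (r k) * cis (2 * pi * t) ^ d) / (1 + r k)))
        \<longlonglongrightarrow> ln (cmod (1 - of_real 1 * cis (2 * pi * t) ^ d) / (1 + 1))"
      by (intro tendsto_intros r_lim) auto
    then show ?thesis using False by (simp add: F_def G_def)
  qed (simp add: F_def G_def)
  have int_F: "integral {0..1} (F k) = - ln (1 + r k)" for k using F_int by (rule integral_unique)
  have int_lim: "(\<lambda>k. integral {0..1} (F k)) \<longlonglongrightarrow> - ln 2"
  proof -
    have "(\<lambda>k. - ln (1 + r k)) \<longlonglongrightarrow> - ln (1 + 1)" by (intro tendsto_intros r_lim) auto
    then show ?thesis by (simp add: int_F)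
  qed
  have "G integrable_on {0..1} \<and> (\<lambda>k. integral {0..1} (F k)) \<longlonglongrightarrow> integral {0..1} G"
  proof (rule monotone_convergence_decreasing)
    show "bounded (range (\<lambda>k. integral {0..1} (F k)))"
      using int_lim by (rule convergent_imp_bounded)
  qed (use F_int mono lim in \<open>auto simp: integrable_on_def\<close>)
  then have "(G has_integral - ln 2) {0..1}"
    using int_lim LIMSEQ_unique integrable_integral by metis
  from has_integral_add[OF this has_integral_const_real[of "ln 2" 0 1]]
  have int: "((\<lambda>t. G t + ln 2) has_integral 0) {0..1}" by simp
  show ?thesis
  proof (rule has_integral_spike_finite[OF Z _ int])
    fix t assume "t \<in> {0..1} - Z"
    then have "cmod (cis (2 * pi * t) ^ d - 1) > 0" "t \<notin> Z" by (auto simp: Z_def)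
    then show "ln (cmod (cis (2 * pi * t) ^ d - 1)) = G t + ln 2"
      by (simp add: G_def ln_div norm_minus_commute)
  qed
qed

section \<open>Polynomials without zeros on the unit circle\<close>

definition log_mahler :: "complex poly \<Rightarrow> real" where
  "log_mahler p = integral {0..1} (\<lambda>t. ln (cmod (poly p (cis (2 * pi * t)))))"

text \<open>
  The product over the rotated roots of unity is required to be asymptotic to the \<open>n\<close>-th power of
  the Mahler measure with a relative error that tends to \<open>0\<close>, which is stronger than convergence of
  logarithmic averages. The rotation \<open>u n\<close> may vary with \<open>n\<close>: the \<open>n\<close>-th roots of \<open>-1\<close> are those of
  unity rotated by \<open>exp (\<pi> \<i> / n)\<close>.
\<close>

definition circle_regular :: "complex poly \<Rightarrow> bool" where
  "circle_regular p \<longleftrightarrow> (\<forall>z. cmod z = 1 \<longrightarrow> poly p z \<noteq> 0) \<and>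
     (\<lambda>t. ln (cmod (poly p (cis (2 * pi * t))))) integrable_on {0..1} \<and>
     (\<forall>u. (\<forall>n. cmod (u n) = 1) \<longrightarrow>
        (\<lambda>n. (\<Prod>j<n. cmod (poly p (u n * cis (2 * pi * real j / real n)))) / exp (log_mahler p) ^ n) \<longlonglongrightarrow> 1)"

lemma circle_regular_const:
  assumes "c \<noteq> 0"
  shows "circle_regular [:c:]"
proof -
  have "log_mahler [:c:] = ln (cmod c)" by (simp add: log_mahler_def)
  then show ?thesis using assms by (simp add: circle_regular_def integrable_on_const)
qed

lemma circle_regular_mult:
  assumes p: "circle_regular p" and q: "circle_regular q"
  shows "circle_regular (p * q)"
proof -
  have nz: "poly p (cis x) \<noteq> 0" "poly q (cis x) \<noteq> 0" for x
    using p q by (auto simp: circle_regular_def)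
  have ln: "ln (cmod (poly (p * q) (cis (2 * pi * t)))) =
      ln (cmod (poly p (cis (2 * pi * t)))) + ln (cmod (poly q (cis (2 * pi * t))))" for t
    using nz by (simp add: norm_mult ln_mult)
  have int: "(\<lambda>t. ln (cmod (poly p (cis (2 * pi * t))))) integrable_on {0..1}"
      "(\<lambda>t. ln (cmod (poly q (cis (2 * pi * t))))) integrable_on {0..1}"
    using p q by (auto simp: circle_regular_def)
  have m: "log_mahler (p * q) = log_mahler p + log_mahler q"
    unfolding log_mahler_def ln by (rule integral_add[OF int])
  show ?thesis unfolding circle_regular_def
  proof (intro conjI allI impI)
    fix z :: complex assume "cmod z = 1"
    then show "poly (p * q) z \<noteq> 0" using p q by (auto simp: circle_regular_def)
  next
    show "(\<lambda>t. ln (cmod (poly (p * q) (cis (2 * pi * t))))) integrable_on {0..1}"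
      unfolding ln by (rule integrable_add[OF int])
  next
    fix u :: "nat \<Rightarrow> complex" assume u: "\<forall>n. cmod (u n) = 1"
    let ?P = "\<lambda>p n. (\<Prod>j<n. cmod (poly p (u n * cis (2 * pi * real j / real n)))) / exp (log_mahler p) ^ n"
    have "?P p \<longlonglongrightarrow> 1" "?P q \<longlonglongrightarrow> 1" using p q u by (auto simp: circle_regular_def)
    from tendsto_mult[OF this] have "(\<lambda>n. ?P p n * ?P q n) \<longlonglongrightarrow> 1" by simp
    moreover have "?P p n * ?P q n = ?P (p * q) n" for n
      by (simp add: m exp_add norm_mult prod.distrib power_mult_distrib)
    ultimately show "?P (p * q) \<longlonglongrightarrow> 1" by simp
  qed
qed

lemma norm_diff_tendsto_one:
  fixes x y :: "nat \<Rightarrow> complex"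
  assumes x: "\<And>n. cmod (x n) = 1" and y: "y \<longlonglongrightarrow> 0"
  shows "(\<lambda>n. cmod (x n - y n)) \<longlonglongrightarrow> 1"
proof (rule tendsto_sandwich)
  have "(\<lambda>n. cmod (y n)) \<longlonglongrightarrow> 0" using y by (rule tendsto_norm_zero)
  then show "(\<lambda>n. 1 - cmod (y n)) \<longlonglongrightarrow> 1" "(\<lambda>n. 1 + cmod (y n)) \<longlonglongrightarrow> 1"
    using tendsto_diff[OF tendsto_const, of "\<lambda>n. cmod (y n)" 0 sequentially 1]
      tendsto_add[OF tendsto_const, of "\<lambda>n. cmod (y n)" 0 sequentially 1] by simp_all
  show "\<forall>\<^sub>F n in sequentially. 1 - cmod (y n) \<le> cmod (x n - y n)"
    using norm_triangle_ineq2[of "x _" "y _"] x by (intro always_eventually) (metis)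
  show "\<forall>\<^sub>F n in sequentially. cmod (x n - y n) \<le> 1 + cmod (y n)"
    using norm_triangle_ineq4[of "x _" "y _"] x by (intro always_eventually) (metis)
qed

text \<open>
  If \<open>\<bar>a\<bar> < 1\<close>, then \<open>u ^ n - a ^ n\<close> differs from a number of modulus \<open>1\<close> by a null sequence and the
  logarithmic mean is \<open>0\<close>. If \<open>\<bar>a\<bar> > 1\<close>, then \<open>a ^ n\<close> dominates and the mean is \<open>ln \<bar>a\<bar>\<close>.
\<close>

lemma circle_regular_linear:
  assumes a: "cmod a \<noteq> 1"
  shows "circle_regular [:-a, 1:]"
proof -
  obtain m where int: "((\<lambda>t. ln (cmod (cis (2 * pi * t) - a))) has_integral m) {0..1}"
    and lim: "\<And>u. (\<And>n. cmod (u n) = 1) \<Longrightarrow> (\<lambda>n. cmod (u n ^ n - a ^ n) / exp m ^ n) \<longlonglongrightarrow> 1"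
  proof (cases "cmod a < 1")
    case True
    have "(\<lambda>n. cmod (u n ^ n - a ^ n) / exp 0 ^ n) \<longlonglongrightarrow> 1" if "\<And>n. cmod (u n) = 1" for u
      using norm_diff_tendsto_one[of "\<lambda>n. u n ^ n" "\<lambda>n. a ^ n"] that True
      by (simp add: norm_power LIMSEQ_power_zero)
    with circle_mean_ln_norm_inside[OF True] show ?thesis using that by blast
  next
    case False
    with a have a1: "cmod a > 1" by simp
    have "(\<lambda>n. cmod (u n ^ n - a ^ n) / exp (ln (cmod a)) ^ n) \<longlonglongrightarrow> 1" if u: "\<And>n. cmod (u n) = 1" for u
    proof -
      have "(\<lambda>n. (1 / a) ^ n) \<longlonglongrightarrow> 0" using a1 by (intro LIMSEQ_power_zero) (use a1 in \<open>simp add: norm_divide divide_simps\<close>)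
      moreover have "(\<lambda>n. cmod ((u n / a) ^ n)) \<longlonglongrightarrow> 0"
        using tendsto_norm_zero[OF calculation] u by (simp add: norm_divide norm_power)
      then have "(\<lambda>n. (u n / a) ^ n) \<longlonglongrightarrow> 0" by (rule tendsto_norm_zero_cancel)
      ultimately have "(\<lambda>n. cmod (1 - (u n / a) ^ n)) \<longlonglongrightarrow> 1"
        using norm_diff_tendsto_one[of "\<lambda>_. 1" "\<lambda>n. (u n / a) ^ n"] by simp
      moreover have "cmod (1 - (u n / a) ^ n) = cmod (u n ^ n - a ^ n) / exp (ln (cmod a)) ^ n" for n
      proof -
        have "cmod (u n ^ n - a ^ n) / cmod a ^ n = cmod ((a ^ n - u n ^ n) / a ^ n)"
          by (simp add: norm_divide norm_power norm_minus_commute)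
        also have "(a ^ n - u n ^ n) / a ^ n = 1 - (u n / a) ^ n"
          using a1 by (auto simp: diff_divide_distrib power_divide)
        finally have "cmod (u n ^ n - a ^ n) / cmod a ^ n = cmod (1 - (u n / a) ^ n)" .
        moreover have "exp (ln (cmod a)) = cmod a" using a1 by (intro exp_ln) linarith
        ultimately show ?thesis by (simp only:)
      qed
      ultimately show ?thesis by simp
    qed
    with circle_mean_ln_norm_outside[OF a1] show ?thesis using that by blast
  qed
  have m: "log_mahler [:-a, 1:] = m"
    unfolding log_mahler_def using integral_unique[OF int] by simp
  show ?thesis unfolding circle_regular_def
  proof (intro conjI allI impI)
    fix z :: complex assume "cmod z = 1"
    then show "poly [:-a, 1:] z \<noteq> 0" using a by auto
  next
    show "(\<lambda>t. ln (cmod (poly [:- a, 1:] (cis (2 * pi * t))))) integrable_on {0..1}"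
      using has_integral_integrable[OF int] by simp
  next
    fix u :: "nat \<Rightarrow> complex" assume u: "\<forall>n. cmod (u n) = 1"
    show "(\<lambda>n. (\<Prod>j<n. cmod (poly [:-a, 1:] (u n * cis (2 * pi * real j / real n)))) / exp (log_mahler [:-a, 1:]) ^ n) \<longlonglongrightarrow> 1"
      unfolding m
    proof (rule Lim_transform_eventually[OF lim])
      show "\<forall>\<^sub>F n in sequentially. cmod (u n ^ n - a ^ n) / exp m ^ n =
          (\<Prod>j<n. cmod (poly [:-a, 1:] (u n * cis (2 * pi * real j / real n)))) / exp m ^ n"
        using eventually_gt_at_top[of 0]
      proof eventually_elim
        case (elim n)
        then show ?case using prod_norm_rotated_roots[of n "u n" a] u by simp
      qed
    qed (use u in auto)
  qed
qed

text \<open>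
  The property is multiplicative, so it suffices to factor \<open>p\<close> over the complex numbers.
\<close>

theorem circle_regularI:
  assumes nz: "\<And>z. cmod z = 1 \<Longrightarrow> poly p z \<noteq> 0"
  shows "circle_regular p"
proof -
  obtain root where p: "p = Polynomial.smult (lead_coeff p) (\<Prod>i<degree p. [:-root i, 1:])"
    using complex_poly_decompose' by metis
  have p0: "p \<noteq> 0" using nz[of 1] by auto
  have root: "cmod (root i) \<noteq> 1" if "i < degree p" for i
  proof -
    have "poly p (root i) = 0"
      by (subst p) (use that in \<open>auto simp: poly_prod prod_zero_iff\<close>)
    with nz show ?thesis by auto
  qed
  have "circle_regular (\<Prod>i\<in>I. [:-root i, 1:])" if "finite I" "I \<subseteq> {..<degree p}" for I
    using that
  proof (induction I rule: finite_induct)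
    case empty
    then show ?case using circle_regular_const[of 1] by (simp add: one_pCons)
  next
    case (insert i I)
    then have "cmod (root i) \<noteq> 1" using root by auto
    with insert show ?case by (simp add: circle_regular_mult circle_regular_linear del: mult_pCons_left)
  qed
  from this[of "{..<degree p}"]
  have "circle_regular ([:lead_coeff p:] * (\<Prod>i<degree p. [:-root i, 1:]))"
    using p0 by (intro circle_regular_mult circle_regular_const) auto
  also have "[:lead_coeff p:] * (\<Prod>i<degree p. [:-root i, 1:]) = p"
    by (subst (4) p) simp
  finally show ?thesis .
qed

section \<open>The Laurent polynomial on the unit circle\<close>

lemma circulant_laurent_eq:
  assumes z: "cmod z = 1"
  shows "circulant_laurent k s z = (\<Sum>i=1..k. (1 - z ^ s i) + (1 - cnj (z ^ s i)))"
proof -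
  have "z powi int m + z powi (- int m) = z ^ m + cnj (z ^ m)" for m
    using divide_conv_cnj[of "z ^ m" 1] z
    by (simp add: power_int_minus norm_power divide_inverse)
  then show ?thesis
    by (simp add: circulant_laurent_def sum.distrib sum_subtractf sum_negf)
qed

text \<open>
  This locates the zeros of \<open>L\<close> on the unit circle and shows that \<open>L + 2\<close> has none there.
\<close>

lemma circulant_laurent_eq_sum_squares:
  assumes z: "cmod z = 1"
  shows "circulant_laurent k s z = of_real (\<Sum>i=1..k. (cmod (1 - z ^ s i))\<^sup>2)"
proof -
  have "(1 - y) + (1 - cnj y) = of_real ((cmod (1 - y))\<^sup>2)" if "cmod y = 1" for y
  proof -
    have "y * cnj y = 1" using that by (simp flip: complex_norm_square)
    then show ?thesis unfolding complex_norm_square by (simp add: algebra_simps)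
  qed
  from this[of "z ^ s _"] show ?thesis
    unfolding circulant_laurent_eq[OF z] by (simp add: norm_power z)
qed

lemma power_Gcd_eq_1:
  fixes z :: complex
  assumes "finite A" and "\<And>a. a \<in> A \<Longrightarrow> z ^ a = 1"
  shows "z ^ Gcd A = 1"
  using assms
proof (induction A rule: finite_induct)
  case (insert a A)
  then have a: "z ^ a = 1" and g: "z ^ Gcd A = 1" by auto
  show ?case
  proof (cases "a = 0")
    case False
    then obtain x y where "a * x = Gcd A * y + gcd a (Gcd A)" using bezout_nat by blast
    then have "z ^ (a * x) = z ^ (Gcd A * y) * z ^ gcd a (Gcd A)" by (simp add: power_add)
    then show ?thesis using a g by (simp add: power_mult)
  qed (use g in simp)
qed simp

text \<open>
  For \<open>z \<noteq> 0\<close> the value is \<open>- z ^ s\<^sub>k L z / (z ^ d - 1)\<^sup>2\<close> wherever the denominator does not vanish,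
  provided that \<open>s\<^sub>k\<close> is the largest of the jumps and \<open>d\<close> divides all of them. It is a polynomial
  because \<open>2 - z ^ s - z powi - s = - z powi - s (z ^ s - 1)\<^sup>2\<close>, and \<open>z ^ s - 1\<close> is then \<open>z ^ d - 1\<close> times a geometric sum.
\<close>

definition laurent_quotient :: "nat \<Rightarrow> (nat \<Rightarrow> nat) \<Rightarrow> nat \<Rightarrow> complex poly" where
  "laurent_quotient k s d =
     (\<Sum>i=1..k. monom 1 (s k - s i) * (\<Sum>m<s i div d. monom 1 (d * m))\<^sup>2)"

text \<open>
  This is \<open>z ^ s\<^sub>k (L z + 2)\<close>, a polynomial in \<open>z\<close> if \<open>s\<^sub>k\<close> is the largest of the jumps.
\<close>

definition laurent_plus_two :: "nat \<Rightarrow> (nat \<Rightarrow> nat) \<Rightarrow> complex poly" where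
  "laurent_plus_two k s = monom (2 * of_nat k + 2) (s k) - (\<Sum>i=1..k. monom 1 (s k + s i) + monom 1 (s k - s i))"

lemma laurent_times_power:
  assumes z: "z \<noteq> 0" and le: "\<And>i. i \<in> {1..k} \<Longrightarrow> s i \<le> s k"
  shows "z ^ s k * circulant_laurent k s z =
    2 * of_nat k * z ^ s k - (\<Sum>i=1..k. z ^ (s k + s i) + z ^ (s k - s i))"
proof -
  have "z ^ s k * (z powi int (s i) + z powi (- int (s i))) = z ^ (s k + s i) + z ^ (s k - s i)"
    if "i \<in> {1..k}" for i
  proof -
    have "z ^ s k = z ^ (s k - s i) * z ^ s i" using le[OF that] by (simp flip: power_add)
    then show ?thesis using z by (simp add: power_int_minus distrib_left power_add)
  qed
  then show ?thesis
    by (simp add: circulant_laurent_def right_diff_distrib sum_distrib_left algebra_simps)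
qed

lemma poly_laurent_plus_two:
  assumes "z \<noteq> 0" and "\<And>i. i \<in> {1..k} \<Longrightarrow> s i \<le> s k"
  shows "poly (laurent_plus_two k s) z = z ^ s k * (circulant_laurent k s z + 2)"
  using laurent_times_power[where s = s and k = k, OF assms]
  by (simp add: laurent_plus_two_def poly_monom poly_sum algebra_simps)

lemma poly_laurent_quotient:
  assumes z: "z \<noteq> 0" and le: "\<And>i. i \<in> {1..k} \<Longrightarrow> s i \<le> s k"
    and dvd: "\<And>i. i \<in> {1..k} \<Longrightarrow> d dvd s i"
  shows "(z ^ d - 1)\<^sup>2 * poly (laurent_quotient k s d) z = - (z ^ s k * circulant_laurent k s z)"
proof -
  have "(z ^ d - 1)\<^sup>2 * poly (laurent_quotient k s d) z =
      (\<Sum>i=1..k. z ^ (s k - s i) * ((z ^ d - 1) * (\<Sum>m<s i div d. (z ^ d) ^ m))\<^sup>2)"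
    unfolding laurent_quotient_def poly_sum sum_distrib_left[of "(z ^ d - 1)\<^sup>2"] poly_mult poly_power poly_monom
      power_mult_distrib power_mult mult.left_commute[of "(z ^ d - 1)\<^sup>2"] mult_1_left ..
  also have "\<dots> = (\<Sum>i=1..k. z ^ (s k + s i) + z ^ (s k - s i) - 2 * z ^ s k)"
  proof (rule sum.cong[OF refl])
    fix i assume i: "i \<in> {1..k}"
    have "(z ^ d - 1) * (\<Sum>m<s i div d. (z ^ d) ^ m) = (z ^ d) ^ (s i div d) - 1"
      by (rule power_diff_1_eq[symmetric])
    also have "(z ^ d) ^ (s i div d) = z ^ s i" using dvd[OF i] by (simp flip: power_mult)
    finally have g: "(z ^ d - 1) * (\<Sum>m<s i div d. (z ^ d) ^ m) = z ^ s i - 1" .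
    have "z ^ s k = z ^ (s k - s i) * z ^ s i" using le[OF i] by (simp flip: power_add)
    then show "z ^ (s k - s i) * ((z ^ d - 1) * (\<Sum>m<s i div d. (z ^ d) ^ m))\<^sup>2 =
        z ^ (s k + s i) + z ^ (s k - s i) - 2 * z ^ s k"
      unfolding g by (simp add: power2_eq_square power_add algebra_simps)
  qed
  also have "\<dots> = - (z ^ s k * circulant_laurent k s z)"
    using laurent_times_power[where s = s and k = k, OF z le] by (simp add: sum_subtractf)
  finally show ?thesis .
qed

text \<open>
  The geometric sums consist of \<open>s\<^sub>i / d\<close> terms equal to \<open>1\<close>.
\<close>

lemma poly_laurent_quotient_root:
  assumes z: "z ^ d = 1" and dvd: "\<And>i. i \<in> {1..k} \<Longrightarrow> d dvd s i" and k: "k \<ge> 1"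
  shows "poly (laurent_quotient k s d) z = of_nat (\<Sum>i=1..k. (s i div d)\<^sup>2)"
proof -
  have "z ^ (s k - s i) = 1" if "i \<in> {1..k}" for i
  proof -
    have "d dvd s k - s i" using dvd[OF that] dvd[of k] k by (simp add: dvd_diff_nat)
    then show ?thesis using z by (auto simp: power_mult elim!: dvdE)
  qed
  then show ?thesis
    by (simp add: laurent_quotient_def poly_sum poly_monom power_mult z)
qed

text \<open>
  A zero on the circle is a zero of \<open>L\<close>, so all \<open>z ^ s\<^sub>i\<close> are \<open>1\<close> and therefore \<open>z ^ d = 1\<close>; but at
  such \<open>z\<close> the value is a positive integer.
\<close>

lemma laurent_quotient_nonzero_on_circle:
  assumes z: "cmod z = 1" and k: "k \<ge> 1" and d: "d = Gcd (s ` {1..k})"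
    and le: "\<And>i. i \<in> {1..k} \<Longrightarrow> s i \<le> s k" and pos: "\<And>i. i \<in> {1..k} \<Longrightarrow> s i > 0"
  shows "poly (laurent_quotient k s d) z \<noteq> 0"
proof
  assume 0: "poly (laurent_quotient k s d) z = 0"
  have dvd: "d dvd s i" if "i \<in> {1..k}" for i using that by (auto simp: d)
  have z0: "z \<noteq> 0" using z by auto
  have "circulant_laurent k s z = 0"
    using poly_laurent_quotient[where s = s and k = k, OF z0 le dvd] 0 z0 by simp
  then have "(\<Sum>i=1..k. (cmod (1 - z ^ s i))\<^sup>2) = 0"
    unfolding circulant_laurent_eq_sum_squares[OF z] by (simp only: of_real_eq_0_iff)
  then have "\<forall>i\<in>{1..k}. z ^ s i = 1"
    by (subst (asm) sum_nonneg_eq_0_iff) auto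
  then have "z ^ d = 1" unfolding d by (intro power_Gcd_eq_1) auto
  then have "of_nat (\<Sum>i=1..k. (s i div d)\<^sup>2) = (0 :: complex)"
    using poly_laurent_quotient_root[of z d k s] dvd k 0 by metis
  then have "(\<Sum>i=1..k. (s i div d)\<^sup>2) = 0" by (simp only: of_nat_eq_0_iff)
  then have "s k div d = 0" using k by simp
  then show False using dvd[of k] pos[of k] k by (auto elim: dvdE)
qed

lemma norm_circulant_laurent:
  assumes z: "cmod z = 1" and le: "\<And>i. i \<in> {1..k} \<Longrightarrow> s i \<le> s k"
    and dvd: "\<And>i. i \<in> {1..k} \<Longrightarrow> d dvd s i"
  shows "cmod (circulant_laurent k s z) = (cmod (z ^ d - 1))\<^sup>2 * cmod (poly (laurent_quotient k s d) z)"
proof -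
  have "z \<noteq> 0" using z by auto
  then have "cmod ((z ^ d - 1)\<^sup>2 * poly (laurent_quotient k s d) z) = cmod (- (z ^ s k * circulant_laurent k s z))"
    using poly_laurent_quotient[of z k s d] le dvd by metis
  then show ?thesis by (simp add: norm_mult norm_power z)
qed

lemma norm_circulant_laurent_plus_two:
  assumes z: "cmod z = 1" and le: "\<And>i. i \<in> {1..k} \<Longrightarrow> s i \<le> s k"
  shows "cmod (circulant_laurent k s z + 2) = cmod (poly (laurent_plus_two k s) z)"
proof -
  have "z \<noteq> 0" using z by auto
  then have "poly (laurent_plus_two k s) z = z ^ s k * (circulant_laurent k s z + 2)"
    using le by (rule poly_laurent_plus_two)
  then show ?thesis by (simp add: norm_mult norm_power z)
qed

lemma laurent_plus_two_nonzero_on_circle: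
  assumes z: "cmod z = 1" and le: "\<And>i. i \<in> {1..k} \<Longrightarrow> s i \<le> s k"
  shows "poly (laurent_plus_two k s) z \<noteq> 0"
proof -
  have "Re (circulant_laurent k s z + 2) > 0"
    unfolding circulant_laurent_eq_sum_squares[OF z]
    by (simp add: add_nonneg_pos sum_nonneg)
  then have "circulant_laurent k s z + 2 \<noteq> 0" by (metis less_irrefl zero_complex.sel(1))
  then show ?thesis using norm_circulant_laurent_plus_two[of z k s, OF z] le by auto
qed

section \<open>The exact number of spanning trees\<close>

text \<open>
  The jump \<open>n\<close> is its own negative modulo \<open>2 n\<close>, so it contributes the single term \<open>1 - w ^ n\<close>
  with \<open>w = exp (\<pi> \<i> j / n)\<close>, which is \<open>0\<close> or \<open>2\<close> according to the parity of \<open>j\<close>.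
\<close>

lemma circulant_eigenvalue_doubled:
  fixes s :: "nat \<Rightarrow> nat"
  assumes n: "n > 0" and inj: "inj_on s {1..k}" and s: "\<And>i. i \<in> {1..k} \<Longrightarrow> 0 < s i \<and> s i < n"
  defines "S \<equiv> insert n (s ` {1..k})"
  shows "circulant_eigenvalue (2 * n) (S \<union> (\<lambda>a. 2 * n - a) ` S) j =
    circulant_laurent k s (cis (pi * real j / real n)) + (1 - (-1) ^ j)"
proof -
  define w where "w = cis (pi * real j / real n)"
  have w: "cmod w = 1" by (simp add: w_def)
  have w_eq: "cis (2 * pi * real j / real (2 * n)) = w" by (simp add: w_def)
  have wn: "w ^ n = (-1) ^ j"
  proof -
    have "real n * (pi * real j / real n) = real j * pi" using n by simp
    then have "w ^ n = cis (real j * pi)" by (simp only: w_def Complex.DeMoivre)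
    also have "\<dots> = cis pi ^ j" by (simp only: Complex.DeMoivre)
    finally show ?thesis by simp
  qed
  have reflect: "w ^ (2 * n - m) = cnj (w ^ m)" if "m \<le> 2 * n" for m
  proof -
    have "w ^ (2 * n - m) * w ^ m = (w ^ n)\<^sup>2" using that by (simp flip: power_add power_mult add: mult.commute)
    also have "\<dots> = 1" by (simp add: wn flip: power_mult)
    finally have "w ^ (2 * n - m) * w ^ m = 1" .
    moreover have "w ^ m * cnj (w ^ m) = 1"
      using complex_norm_square[of "w ^ m"] w by (simp add: norm_power)
    ultimately show ?thesis by (metis mult.assoc mult_1_left mult_1_right)
  qed
  have A: "S \<union> (\<lambda>a. 2 * n - a) ` S = insert n (s ` {1..k} \<union> (\<lambda>i. 2 * n - s i) ` {1..k})"
    by (auto simp: S_def)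
  have n1: "n \<notin> s ` {1..k} \<union> (\<lambda>i. 2 * n - s i) ` {1..k}" using s by fastforce
  have disj: "s ` {1..k} \<inter> (\<lambda>i. 2 * n - s i) ` {1..k} = {}"
  proof (rule equals0I)
    fix x assume "x \<in> s ` {1..k} \<inter> (\<lambda>i. 2 * n - s i) ` {1..k}"
    then obtain i i' where "i \<in> {1..k}" "i' \<in> {1..k}" "s i = 2 * n - s i'" by auto
    then show False using s[of i] s[of i'] by linarith
  qed
  have inj2: "inj_on (\<lambda>i. 2 * n - s i) {1..k}"
  proof (rule inj_onI)
    fix i i' assume i: "i \<in> {1..k}" "i' \<in> {1..k}" "2 * n - s i = 2 * n - s i'"
    then have "s i = s i'" using s[of i] s[of i'] by linarith
    then show "i = i'" using inj i by (auto dest: inj_onD)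
  qed
  have "circulant_eigenvalue (2 * n) (S \<union> (\<lambda>a. 2 * n - a) ` S) j =
      (1 - w ^ n) + ((\<Sum>i=1..k. 1 - w ^ s i) + (\<Sum>i=1..k. 1 - w ^ (2 * n - s i)))"
  proof -
    let ?X = "s ` {1..k}" and ?Y = "(\<lambda>i. 2 * n - s i) ` {1..k}"
    have "(\<Sum>a\<in>insert n (?X \<union> ?Y). 1 - w ^ a) = (1 - w ^ n) + (\<Sum>a\<in>?X \<union> ?Y. 1 - w ^ a)"
      by (rule sum.insert[OF _ n1]) simp
    also have "(\<Sum>a\<in>?X \<union> ?Y. 1 - w ^ a) = (\<Sum>a\<in>?X. 1 - w ^ a) + (\<Sum>a\<in>?Y. 1 - w ^ a)"
      by (rule sum.union_disjoint[OF _ _ disj]) simp_all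
    finally show ?thesis
      unfolding circulant_eigenvalue_def w_eq A sum.reindex[OF inj] sum.reindex[OF inj2] o_def .
  qed
  also have "(\<Sum>i=1..k. 1 - w ^ (2 * n - s i)) = (\<Sum>i=1..k. 1 - cnj (w ^ s i))"
  proof (rule sum.cong[OF refl])
    fix i assume "i \<in> {1..k}"
    then have "s i \<le> 2 * n" using s[of i] by simp
    then show "1 - w ^ (2 * n - s i) = 1 - cnj (w ^ s i)" by (simp only: reflect)
  qed
  also have "(\<Sum>i=1..k. 1 - w ^ s i) + (\<Sum>i=1..k. 1 - cnj (w ^ s i)) = circulant_laurent k s w"
    unfolding circulant_laurent_eq[OF w] by (rule sum.distrib[symmetric])
  finally show ?thesis unfolding wn unfolding w_def by (simp only: add.commute)
qed

lemma prod_even_odd: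
  fixes g :: "nat \<Rightarrow> 'a::comm_monoid_mult"
  shows "(\<Prod>j = 1..<2 * n. g j) = (\<Prod>m = 1..<n. g (2 * m)) * (\<Prod>m<n. g (2 * m + 1))"
proof (induction n)
  case (Suc n)
  show ?case
  proof (cases "n = 0")
    case False
    have "{1..<2 * Suc n} = insert (2 * n) (insert (2 * n + 1) {1..<2 * n})" using False by auto
    moreover have "{1..<Suc n} = insert n {1..<n}" using False by auto
    ultimately show ?thesis using Suc by (simp add: mult_ac)
  qed (simp add: numeral_2_eq_2)
qed simp


text \<open>
  The eigenvalues of even index are the values of \<open>L\<close> at the \<open>n\<close>-th roots of unity other than \<open>1\<close>, and those
  of odd index the values of \<open>L + 2\<close> at the \<open>n\<close>-th roots of \<open>-1\<close>. Dividing by \<open>\<bar>R 1\<bar>\<close> compensates for completing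
  the product of \<open>\<bar>R\<bar>\<close> by the factor at \<open>1\<close>.
\<close>

lemma spanning_trees_exact:
  fixes s :: "nat \<Rightarrow> nat"
  assumes k: "k \<ge> 1" and inj: "inj_on s {1..k}"
    and s: "\<And>i. i \<in> {1..k} \<Longrightarrow> 0 < s i \<and> s i \<le> s k"
    and n: "s k < n" and cop: "coprime n (Gcd (s ` {1..k}))"
  defines "d \<equiv> Gcd (s ` {1..k})"
  defines "R \<equiv> laurent_quotient k s d" and "Q \<equiv> laurent_plus_two k s"
  shows "real (2 * n * circulant_num_spanning_trees (2 * n) (insert n (s ` {1..k}))) =
    (real n)\<^sup>2 * (\<Prod>j<n. cmod (poly R (cis (2 * pi * real j / real n)))) / cmod (poly R 1) *
    (\<Prod>j<n. cmod (poly Q (cis (pi / real n) * cis (2 * pi * real j / real n))))"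
proof -
  define S where "S = insert n (s ` {1..k})"
  define U where "U = {w::complex. w ^ n = 1}"
  define ev where "ev = circulant_eigenvalue (2 * n) (S \<union> (\<lambda>a. 2 * n - a) ` S)"
  have n0: "n > 0" using n by simp
  have fin: "finite U" unfolding U_def using n0 by (simp add: finite_roots_unity)
  have U1: "1 \<in> U" by (simp add: U_def)
  have norm_U: "cmod w = 1" if "w \<in> U" for w
    using that n0 power_eq_1_iff[of w n] by (auto simp: U_def)
  have dvd: "d dvd s i" if "i \<in> {1..k}" for i using that by (auto simp: d_def)
  have le: "s i \<le> s k" if "i \<in> {1..k}" for i using s[OF that] by simp
  have SN: "S \<subseteq> {1..<2 * n}" using s n by (fastforce simp: S_def)
  have ev: "ev j = circulant_laurent k s (cis (pi * real j / real n)) + (1 - (-1) ^ j)" for j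
    unfolding ev_def S_def
    by (rule circulant_eigenvalue_doubled[OF n0 inj]) (use s n in fastforce)
  have R1: "poly R 1 \<noteq> 0"
    unfolding R_def by (rule laurent_quotient_nonzero_on_circle[OF _ k d_def[THEN meta_eq_to_obj_eq]]) (use s in auto)
  have "real (2 * n * circulant_num_spanning_trees (2 * n) S) = cmod (\<Prod>j = 1..<2 * n. ev j)"
    unfolding ev_def using circulant_num_spanning_trees_prod[OF _ SN] n0
    by (metis norm_of_nat mult_pos_pos zero_less_numeral)
  also have "\<dots> = (\<Prod>j = 1..<2 * n. cmod (ev j))" by (rule prod_norm[symmetric])
  also have "\<dots> = (\<Prod>m = 1..<n. cmod (ev (2 * m))) * (\<Prod>m<n. cmod (ev (2 * m + 1)))"
    by (rule prod_even_odd)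
  also have "(\<Prod>m<n. cmod (ev (2 * m + 1))) =
      (\<Prod>j<n. cmod (poly Q (cis (pi / real n) * cis (2 * pi * real j / real n))))"
  proof (rule prod.cong[OF refl])
    fix m
    have "cis (pi * real (2 * m + 1) / real n) = cis (pi / real n) * cis (2 * pi * real m / real n)"
      by (simp add: cis_mult add_divide_distrib algebra_simps)
    then show "cmod (ev (2 * m + 1)) = cmod (poly Q (cis (pi / real n) * cis (2 * pi * real m / real n)))"
      unfolding ev Q_def using norm_circulant_laurent_plus_two[of "cis (pi / real n) * cis (2 * pi * real m / real n)" k s] le
      by (simp add: norm_mult)
  qed
  also have "(\<Prod>m = 1..<n. cmod (ev (2 * m))) = (\<Prod>w\<in>U - {1}. (cmod (1 - w ^ d))\<^sup>2 * cmod (poly R w))"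
  proof -
    have "bij_betw (\<lambda>j. cis (2 * pi * real j / real n)) ({..<n} - {0}) (U - {cis (2 * pi * real 0 / real n)})"
      unfolding U_def
      by (rule bij_betw_DiffI[OF Complex.bij_betw_roots_unity[OF n0]]) (use n0 in auto)
    moreover have "{..<n} - {0} = {1..<n}" by auto
    ultimately have bij: "bij_betw (\<lambda>j. cis (2 * pi * real j / real n)) {1..<n} (U - {1})" by simp
    have "(\<Prod>m = 1..<n. cmod (ev (2 * m))) = (\<Prod>m = 1..<n. cmod (circulant_laurent k s (cis (2 * pi * real m / real n))))"
      by (rule prod.cong[OF refl]) (simp add: ev mult_ac)
    also have "\<dots> = (\<Prod>w\<in>U - {1}. cmod (circulant_laurent k s w))"
      by (rule prod.reindex_bij_betw[OF bij])
    also have "\<dots> = (\<Prod>w\<in>U - {1}. (cmod (1 - w ^ d))\<^sup>2 * cmod (poly R w))"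
    proof (rule prod.cong[OF refl])
      fix w assume "w \<in> U - {1}"
      then have "cmod w = 1" using norm_U by auto
      from norm_circulant_laurent[of w k s d, OF this] le dvd
      show "cmod (circulant_laurent k s w) = (cmod (1 - w ^ d))\<^sup>2 * cmod (poly R w)"
        unfolding R_def by (simp add: norm_minus_commute)
    qed
    finally show ?thesis .
  qed
  also have "\<dots> = (cmod (\<Prod>w\<in>U - {1}. 1 - w ^ d))\<^sup>2 * (\<Prod>w\<in>U - {1}. cmod (poly R w))"
    by (simp add: prod.distrib prod_power_distrib flip: prod_norm)
  also have "(\<Prod>w\<in>U - {1}. 1 - w ^ d) = of_nat n"
    unfolding U_def by (rule prod_one_minus_coprime_powers[OF n0]) (use cop in \<open>simp add: d_def\<close>)
  also have "(\<Prod>w\<in>U - {1}. cmod (poly R w)) = (\<Prod>w\<in>U. cmod (poly R w)) / cmod (poly R 1)"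
    using R1 by (simp add: prod.remove[OF fin U1])
  also have "(\<Prod>w\<in>U. cmod (poly R w)) = (\<Prod>j<n. cmod (poly R (cis (2 * pi * real j / real n))))"
    unfolding U_def by (rule prod_roots_of_unity_reindex[OF n0, symmetric])
  finally show ?thesis by (simp add: S_def)
qed

section \<open>Asymptotics\<close>

text \<open>
  The factor \<open>(z ^ d - 1)\<^sup>2\<close> of \<open>L\<close> does not contribute to the mean. The integrands need not agree at
  the finitely many zeros of this factor, where the logarithm takes its value at \<open>0\<close>.
\<close>

lemma log_mahler_laurent:
  fixes s :: "nat \<Rightarrow> nat"
  assumes k: "k \<ge> 1" and s: "\<And>i. i \<in> {1..k} \<Longrightarrow> 0 < s i \<and> s i \<le> s k"
  defines "d \<equiv> Gcd (s ` {1..k})"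
  defines "R \<equiv> laurent_quotient k s d" and "Q \<equiv> laurent_plus_two k s"
  shows "((\<lambda>t. ln (cmod (circulant_laurent k s (cis (2 * pi * t)) * (circulant_laurent k s (cis (2 * pi * t)) + 2))))
    has_integral log_mahler R + log_mahler Q) {0..1}"
proof -
  have dvd: "d dvd s i" if "i \<in> {1..k}" for i using that by (auto simp: d_def)
  have le: "s i \<le> s k" if "i \<in> {1..k}" for i using s[OF that] by simp
  have d0: "d > 0" using dvd[of k] s[of k] k by (auto intro: Nat.gr0I)
  have Rnz: "poly R z \<noteq> 0" if "cmod z = 1" for z
    unfolding R_def by (rule laurent_quotient_nonzero_on_circle[OF that k]) (use s in \<open>auto simp: d_def\<close>)
  have Qnz: "poly Q z \<noteq> 0" if "cmod z = 1" for z
    unfolding Q_def by (rule laurent_plus_two_nonzero_on_circle[OF that]) (use le in auto)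
  have int: "((\<lambda>t. ln (cmod (poly p (cis (2 * pi * t))))) has_integral log_mahler p) {0..1}"
    if "\<And>z. cmod z = 1 \<Longrightarrow> poly p z \<noteq> 0" for p
    using circle_regularI[OF that] unfolding circle_regular_def log_mahler_def
    by (intro integrable_integral) blast
  let ?Z = "{t \<in> {0..1}. cis (2 * pi * t) ^ d = 1}"
  have "((\<lambda>t. 2 * ln (cmod (cis (2 * pi * t) ^ d - 1)) +
      (ln (cmod (poly R (cis (2 * pi * t)))) + ln (cmod (poly Q (cis (2 * pi * t)))))) has_integral
      2 * 0 + (log_mahler R + log_mahler Q)) {0..1}"
    using int[of R] int[of Q] Rnz Qnz
    by (intro has_integral_add has_integral_mult_right circle_mean_ln_norm_power_minus_one[OF d0]) auto
  then have *: "((\<lambda>t. 2 * ln (cmod (cis (2 * pi * t) ^ d - 1)) +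
      (ln (cmod (poly R (cis (2 * pi * t)))) + ln (cmod (poly Q (cis (2 * pi * t)))))) has_integral
      log_mahler R + log_mahler Q) {0..1}" by simp
  show ?thesis
  proof (rule has_integral_spike_finite[OF finite_times_of_roots_of_unity[OF d0] _ *])
    fix t assume "t \<in> {0..1} - ?Z"
    then have "cmod (cis (2 * pi * t) ^ d - 1) > 0" by auto
    moreover have "cmod (poly R (cis (2 * pi * t))) > 0" "cmod (poly Q (cis (2 * pi * t))) > 0"
      using Rnz Qnz by auto
    moreover have "cmod (circulant_laurent k s (cis (2 * pi * t)) * (circulant_laurent k s (cis (2 * pi * t)) + 2)) =
        (cmod (cis (2 * pi * t) ^ d - 1))\<^sup>2 * (cmod (poly R (cis (2 * pi * t))) * cmod (poly Q (cis (2 * pi * t))))"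
      using norm_circulant_laurent[of "cis (2 * pi * t)" k s d] norm_circulant_laurent_plus_two[of "cis (2 * pi * t)" k s] le dvd
      by (simp add: norm_mult R_def Q_def)
    ultimately show "ln (cmod (circulant_laurent k s (cis (2 * pi * t)) * (circulant_laurent k s (cis (2 * pi * t)) + 2))) =
        2 * ln (cmod (cis (2 * pi * t) ^ d - 1)) + (ln (cmod (poly R (cis (2 * pi * t)))) + ln (cmod (poly Q (cis (2 * pi * t)))))"
      by (simp add: ln_mult ln_realpow)
  qed
qed

theorem theorem6:
  fixes k :: nat and s :: "nat \<Rightarrow> nat"
    and d :: nat and q :: nat and K :: real
    and L :: "complex \<Rightarrow> complex" and \<tau> :: "nat \<Rightarrow> nat"
  assumes "k \<ge> 1" and "1 \<le> s 1" and "strict_mono_on {1..k} s"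
  defines "d \<equiv> Gcd (s ` {1..k})"
    and "q \<equiv> (\<Sum>i=1..k. (s i)\<^sup>2)"
    and "L \<equiv> circulant_laurent k s"
    and "K \<equiv> exp (integral {0..1} (\<lambda>t.
            ln (cmod ((L (exp (2 * of_real pi * \<i> * of_real t)))\<^sup>2
                      + 2 * L (exp (2 * of_real pi * \<i> * of_real t))))))"
    and "\<tau> \<equiv> (\<lambda>n. circulant_num_spanning_trees (2 * n) (insert n (s ` {1..k})))"
  shows "K = mahler_measure (\<lambda>z. L z * (L z + 2)) \<and>
    ((\<lambda>n. real (\<tau> n) / (real n * real d ^ 2 / (2 * real q) * K ^ n)) \<longlongrightarrow> 1)
      (inf at_top (principal {n. s k < n \<and> gcd n d = 1}))"
proof
  have factor: "L z ^ 2 + 2 * L z = L z * (L z + 2)" for z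
    by (simp add: power2_eq_square algebra_simps)
  show "K = mahler_measure (\<lambda>z. L z * (L z + 2))"
    by (simp only: K_def mahler_measure_def factor)
  define R where "R = laurent_quotient k s d"
  define Q where "Q = laurent_plus_two k s"
  have s: "0 < s i \<and> s i \<le> s k" if i: "i \<in> {1..k}" for i
  proof -
    have "mono_on {1..k} s" using assms(3) by (rule strict_mono_on_imp_mono_on)
    then have "s 1 \<le> s i" "s i \<le> s k" using i mono_onD[of "{1..k}" s 1 i] mono_onD[of "{1..k}" s i k] by simp_all
    then show ?thesis using assms(2) by simp
  qed
  have inj: "inj_on s {1..k}" using assms(3) by (rule strict_mono_on_imp_inj_on)
  have dvd: "d dvd s i" if "i \<in> {1..k}" for i using that by (auto simp: d_def)
  have d0: "d > 0" using dvd[of k] s[of k] assms(1) by (auto intro: Nat.gr0I)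
  have q0: "q > 0" unfolding q_def using s assms(1) by (intro sum_pos) auto
  have K: "K = exp (log_mahler R) * exp (log_mahler Q)"
  proof -
    have "exp (2 * of_real pi * \<i> * of_real t) = cis (2 * pi * t)" for t
      by (simp add: cis_conv_exp mult_ac)
    then show ?thesis
      unfolding K_def factor unfolding L_def R_def Q_def d_def
      using integral_unique[OF log_mahler_laurent[of k s, OF assms(1) s]] by (simp add: exp_add)
  qed
  have R1: "cmod (poly R 1) = real q / (real d)\<^sup>2"
  proof -
    have "poly R 1 = of_nat (\<Sum>i=1..k. (s i div d)\<^sup>2)"
      unfolding R_def using dvd assms(1) by (intro poly_laurent_quotient_root) auto
    then have "cmod (poly R 1) = real (\<Sum>i=1..k. (s i div d)\<^sup>2)" by (simp only: norm_of_nat)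
    also have "\<dots> = (\<Sum>i=1..k. (real (s i))\<^sup>2 / (real d)\<^sup>2)"
      using dvd by (simp add: real_of_nat_div power_divide)
    finally show ?thesis by (simp add: q_def sum_divide_distrib)
  qed
  let ?F = "inf at_top (principal {n. s k < n \<and> gcd n d = 1})"
  define A where "A n = (\<Prod>j<n. cmod (poly R (1 * cis (2 * pi * real j / real n)))) / exp (log_mahler R) ^ n" for n
  define B where "B n = (\<Prod>j<n. cmod (poly Q (cis (pi / real n) * cis (2 * pi * real j / real n)))) / exp (log_mahler Q) ^ n" for n
  have "circle_regular R" unfolding R_def
    by (intro circle_regularI laurent_quotient_nonzero_on_circle[OF _ assms(1)]) (use s in \<open>auto simp: d_def\<close>)
  then have "A \<longlonglongrightarrow> 1" unfolding A_def circle_regular_def by (elim conjE allE[of _ "\<lambda>_. 1"]) auto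
  moreover have "circle_regular Q" unfolding Q_def
    by (intro circle_regularI laurent_plus_two_nonzero_on_circle) (use s in auto)
  then have "B \<longlonglongrightarrow> 1" unfolding B_def circle_regular_def by (elim conjE allE[of _ "\<lambda>n. cis (pi / real n)"]) auto
  ultimately have "(\<lambda>n. A n * B n) \<longlonglongrightarrow> 1 * 1" by (rule tendsto_mult)
  then have AB: "((\<lambda>n. A n * B n) \<longlongrightarrow> 1) ?F"
    by (intro tendsto_mono[of ?F sequentially]) auto
  show "((\<lambda>n. real (\<tau> n) / (real n * real d ^ 2 / (2 * real q) * K ^ n)) \<longlongrightarrow> 1) ?F"
  proof (rule Lim_transform_eventually[OF AB])
    show "\<forall>\<^sub>F n in ?F. A n * B n = real (\<tau> n) / (real n * real d ^ 2 / (2 * real q) * K ^ n)"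
      unfolding eventually_inf_principal
    proof (intro always_eventually allI impI)
      fix n assume "n \<in> {n. s k < n \<and> gcd n d = 1}"
      then have n: "s k < n" and cop: "coprime n d" by (auto simp: coprime_iff_gcd_eq_1)
      let ?P = "\<Prod>j<n. cmod (poly R (cis (2 * pi * real j / real n)))"
      let ?P' = "\<Prod>j<n. cmod (poly Q (cis (pi / real n) * cis (2 * pi * real j / real n)))"
      have "real (2 * n * \<tau> n) = (real n)\<^sup>2 * ?P / (real q / (real d)\<^sup>2) * ?P'"
        unfolding \<tau>_def R1[symmetric] unfolding R_def Q_def d_def
        by (rule spanning_trees_exact[OF assms(1) inj s n]) (use cop in \<open>auto simp: d_def\<close>)
      define c where "c = real n * (real d)\<^sup>2 / (2 * real q)"
      have "real (\<tau> n) = c * (?P * ?P')"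
        using \<open>real (2 * n * \<tau> n) = _\<close> n d0 q0 by (simp add: c_def field_simps power2_eq_square)
      also have "?P * ?P' = A n * B n * K ^ n"
        by (simp add: A_def B_def K power_mult_distrib)
      also have "c * (A n * B n * K ^ n) = A n * B n * (c * K ^ n)"
        by (simp only: mult.left_commute)
      finally have "real (\<tau> n) = A n * B n * (c * K ^ n)" .
      moreover have "c * K ^ n \<noteq> 0"
        using n d0 q0 by (auto simp: K c_def)
      ultimately have "A n * B n = real (\<tau> n) / (c * K ^ n)" by simp
      then show "A n * B n = real (\<tau> n) / (real n * real d ^ 2 / (2 * real q) * K ^ n)"
        unfolding c_def .
    qed
  qed
qed

end
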